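(* Let $f_1,\dots,f_n:\mathbb{R}^d\to\mathbb{R}$ be convex and $G$-Lipschitz continuous ($|f_i(x)-f_i(y)|\le G\|x-y\|$ for all $x,y$), let $g:\mathbb{R}^d\to\mathbb{R}$ be convex (not necessarily strongly convex), let $F=\frac1n\sum_{i=1}^n f_i+g$ and let $x^\star$ be a minimizer of $F$. By applying both the adaptive regularization and the adaptive smoothing techniques (described in the context) to ASVRG, with suitable parameters, one obtains from the starting point $\widetilde x^0$ an $\varepsilon$-suboptimal solution, i.e. a (random) point $\widehat x$ with $\mathbb{E}[F(\widehat x)]-F(x^\star)\le\varepsilon$, using at most the following oracle complexity: $$\mathcal{O}\left(n\log\frac{F(\widetilde x^0)-F(x^\star)}{\varepsilon}+\frac{\sqrt{n}\,G\,\|\widetilde x^0-x^\star\|}{\varepsilon}\right).$$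
   Context: For $\delta>0$ the $\delta$-Moreau envelope of $f_i$ is $f_i^{\delta}(x)=\inf_{y\in\mathbb{R}^d}\{f_i(y)+\frac{\delta}{2}\|x-y\|^2\}$; it is convex and $\delta$-smooth (differentiable with $\delta$-Lipschitz gradient), and $f_i^\delta\le f_i\le f_i^\delta+\frac{G^2}{2\delta}$. Oracle complexity is the total number of evaluations of component gradients $\nabla f_i^{\delta}(\cdot)$. $\mathcal O$ hides only an absolute constant, and, as usual, $\varepsilon$ is small compared to the initial gap, e.g. $0<\varepsilon\le\frac12(F(\widetilde x^0)-F(x^\star))$. Joint adaptive regularization and smoothing (Allen-Zhu and Hazan): given $\delta_0,\sigma_0>0$ and a number of rounds $T$, set $\widehat x_0=\widetilde x^0$; for $t=0,\dots,T-1$, apply the base algorithm, started at $\widehat x_t$, to the objective $F^{\delta_t,\sigma_t}(x)=\frac1n\sum_i f_i^{\delta_t}(x)+g(x)+\frac{\sigma_t}{2}\|x-\widetilde x^0\|^2$, running it until the expected objective gap of $F^{\delta_t,\sigma_t}$ is reduced to at most $1/4$ of its initial value; call the result $\widehat x_{t+1}$ and put $\delta_{t+1}=2\delta_t$, $\sigma_{t+1}=\sigma_t/2$. The output is $\widehat x_T$. The parameters $\delta_0,\sigma_0,T$ may depend on $F(\widetilde x^0)-F(x^\star)$, $\|\widetilde x^0-x^\star\|$, $G$ and $\varepsilon$. Base algorithm: ASVRG for an objective $\phi+h$, where $\phi=\frac1n\sum_i\phi_i$ with $\phi_i$ convex and $L$-smooth and $h$ $\mu$-strongly convex, with Option II,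 uniform sampling and restarts, with step size $0<\eta<1/L$, momentum parameter $0<\omega\le1-\frac{L\eta}{1-L\eta}$, epoch length $m$, started at $z^0$: set $x_0^1=y_0^1=z^0$. For $s=1,2,\dots$: compute $\nabla\phi(z^{s-1})$; for $t=1,\dots,m$, draw $i_t$ uniformly from $\{1,\dots,n\}$, independently, and set $\widetilde\nabla_t=\nabla\phi_{i_t}(x^s_{t-1})-\nabla\phi_{i_t}(z^{s-1})+\nabla\phi(z^{s-1})$, $y_t^s=\arg\min_y\{\langle\widetilde\nabla_t,y-y^s_{t-1}\rangle+\frac{\omega}{2\eta}\|y-y^s_{t-1}\|^2+h(y)\}$, $x_t^s=z^{s-1}+\omega(y_t^s-z^{s-1})$; then $z^s=\frac1m\sum_{t=1}^m x_t^s$, $y_0^{s+1}=y_m^s$, $x_0^{s+1}=(1-\omega)z^s+\omega y_m^s$. After every $\mathcal S=2\left(\frac{1-\omega}{\omega}+\frac{\omega}{\eta m\mu}\right)$ epochs (rounded up) the procedure is restarted from the initial point $\frac1{\mathcal S}\sum_{s=1}^{\mathcal S}z^s$. Here $\phi_i=f_i^{\delta_t}$, $L=\delta_t$, $h=g+\frac{\sigma_t}{2}\|\cdot-\widetilde x^0\|^2$, $\mu=\sigma_t$. *)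

theory Defs
  imports "HOL-Probability.Probability"
begin

definition moreau_envelope :: "real \<Rightarrow> ('a::euclidean_space \<Rightarrow> real) \<Rightarrow> 'a \<Rightarrow> real" where
  "moreau_envelope \<delta> f x = (INF y. f y + \<delta> / 2 * (norm (x - y))\<^sup>2)"

definition gradient :: "('a::euclidean_space \<Rightarrow> real) \<Rightarrow> 'a \<Rightarrow> 'a" where
  "gradient f x = (THE D. GDERIV f x :> D)"

definition finite_sum_objective ::
    "nat \<Rightarrow> (nat \<Rightarrow> 'a \<Rightarrow> real) \<Rightarrow> ('a \<Rightarrow> real) \<Rightarrow> 'a \<Rightarrow> real" where
  "finite_sum_objective n f g x = (\<Sum>i=1..n. f i x) / real n + g x"


subsection \<open>ASVRG (Option II, uniform sampling, restarts)\<close>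

text \<open>
  The objective is \<open>finite_sum_objective n \<phi> h\<close>. Randomised procedures are probability mass
  functions. The last, natural-number component of every state counts the evaluations of component
  gradients \<open>\<nabla>\<phi>\<^sub>i\<close> made so far.
\<close>

definition full_gradient :: "nat \<Rightarrow> (nat \<Rightarrow> 'a::euclidean_space \<Rightarrow> real) \<Rightarrow> 'a \<Rightarrow> 'a" where
  "full_gradient n \<phi> z = (\<Sum>i=1..n. gradient (\<phi> i) z) /\<^sub>R real n"

definition prox_step ::
    "('a::euclidean_space \<Rightarrow> real) \<Rightarrow> real \<Rightarrow> real \<Rightarrow> 'a \<Rightarrow> 'a \<Rightarrow> 'a" where
  "prox_step h \<eta> \<omega> v y\<^sub>0 =
     (ARG_MIN (\<lambda>y. v \<bullet> (y - y\<^sub>0) + \<omega> / (2 * \<eta>) * (norm (y - y\<^sub>0))\<^sup>2 + h y) y. True)"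

text \<open>
  The inner loop of an epoch with snapshot \<open>z\<close> and \<open>u = \<nabla>\<phi>(z)\<close>. After \<open>t\<close> steps the state is
  \<open>(x\<^sub>t, y\<^sub>t, x\<^sub>1 + \<dots> + x\<^sub>t, c)\<close>. A step evaluates \<open>\<nabla>\<phi>\<^sub>i\<close> at \<open>x\<close> and at \<open>z\<close>, hence costs 2.
\<close>

primrec asvrg_inner ::
    "nat \<Rightarrow> (nat \<Rightarrow> 'a::euclidean_space \<Rightarrow> real) \<Rightarrow> ('a \<Rightarrow> real) \<Rightarrow> real \<Rightarrow> real \<Rightarrow>
     'a \<Rightarrow> 'a \<Rightarrow> 'a \<Rightarrow> 'a \<Rightarrow> nat \<Rightarrow> ('a \<times> 'a \<times> 'a \<times> nat) pmf" where
  "asvrg_inner n \<phi> h \<eta> \<omega> z u x\<^sub>0 y\<^sub>0 0 = return_pmf (x\<^sub>0, y\<^sub>0, 0, 0)"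
| "asvrg_inner n \<phi> h \<eta> \<omega> z u x\<^sub>0 y\<^sub>0 (Suc t) =
     do {
       (x, y, s, c) \<leftarrow> asvrg_inner n \<phi> h \<eta> \<omega> z u x\<^sub>0 y\<^sub>0 t;
       i \<leftarrow> pmf_of_set {1..n};
       let v = gradient (\<phi> i) x - gradient (\<phi> i) z + u;
       let y' = prox_step h \<eta> \<omega> v y;
       let x' = z + \<omega> *\<^sub>R (y' - z);
       return_pmf (x', y', s + x', c + 2)
     }"

text \<open>
  \<open>k\<close> epochs started at \<open>z\<^sub>0\<close>. The state is
  \<open>(z\<^sup>k, x\<^sub>0\<^bsup>k+1\<^esup>, y\<^sub>0\<^bsup>k+1\<^esup>, z\<^sup>1 + \<dots> + z\<^sup>k, c)\<close>. The full gradient costs \<open>n\<close>.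
\<close>

primrec asvrg_epochs ::
    "nat \<Rightarrow> (nat \<Rightarrow> 'a::euclidean_space \<Rightarrow> real) \<Rightarrow> ('a \<Rightarrow> real) \<Rightarrow> real \<Rightarrow> real \<Rightarrow> nat \<Rightarrow>
     'a \<Rightarrow> nat \<Rightarrow> ('a \<times> 'a \<times> 'a \<times> 'a \<times> nat) pmf" where
  "asvrg_epochs n \<phi> h \<eta> \<omega> m z\<^sub>0 0 = return_pmf (z\<^sub>0, z\<^sub>0, z\<^sub>0, 0, 0)"
| "asvrg_epochs n \<phi> h \<eta> \<omega> m z\<^sub>0 (Suc k) =
     do {
       (z, x, y, a, c) \<leftarrow> asvrg_epochs n \<phi> h \<eta> \<omega> m z\<^sub>0 k;
       let u = full_gradient n \<phi> z;
       (x', y', s, c') \<leftarrow> asvrg_inner n \<phi> h \<eta> \<omega> z u x y m;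
       let z' = s /\<^sub>R real m;
       return_pmf (z', (1 - \<omega>) *\<^sub>R z' + \<omega> *\<^sub>R y', y', a + z', c + n + c')
     }"

definition epochs_per_restart :: "real \<Rightarrow> real \<Rightarrow> nat \<Rightarrow> real \<Rightarrow> nat" where
  "epochs_per_restart \<eta> \<omega> m \<mu> =
     nat \<lceil>2 * ((1 - \<omega>) / \<omega> + \<omega> / (\<eta> * real m * \<mu>))\<rceil>"

text \<open>The point reached after \<open>k\<close> restart cycles, with the number of gradient evaluations.\<close>

primrec asvrg ::
    "nat \<Rightarrow> (nat \<Rightarrow> 'a::euclidean_space \<Rightarrow> real) \<Rightarrow> ('a \<Rightarrow> real) \<Rightarrow> real \<Rightarrow> real \<Rightarrow> real \<Rightarrow> nat \<Rightarrow>
     'a \<Rightarrow> nat \<Rightarrow> ('a \<times> nat) pmf" where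
  "asvrg n \<phi> h \<mu> \<eta> \<omega> m z\<^sub>0 0 = return_pmf (z\<^sub>0, 0)"
| "asvrg n \<phi> h \<mu> \<eta> \<omega> m z\<^sub>0 (Suc k) =
     do {
       (z, c) \<leftarrow> asvrg n \<phi> h \<mu> \<eta> \<omega> m z\<^sub>0 k;
       let S = epochs_per_restart \<eta> \<omega> m \<mu>;
       (_, _, _, a, c') \<leftarrow> asvrg_epochs n \<phi> h \<eta> \<omega> m z S;
       return_pmf (a /\<^sub>R real S, c + c')
     }"

definition asvrg_admissible :: "real \<Rightarrow> real \<Rightarrow> real \<Rightarrow> nat \<Rightarrow> bool" where
  "asvrg_admissible L \<eta> \<omega> m \<longleftrightarrow>
     0 < \<eta> \<and> \<eta> < 1 / L \<and> 0 < \<omega> \<and> \<omega> \<le> 1 - L * \<eta> / (1 - L * \<eta>) \<and> 1 \<le> m"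

definition expected_value :: "('a \<Rightarrow> real) \<Rightarrow> ('a \<times> nat) pmf \<Rightarrow> real" where
  "expected_value \<Phi> p = measure_pmf.expectation p (\<lambda>(x, c). \<Phi> x)"

text \<open>Whether \<open>k\<close> restart cycles from \<open>z\<^sub>0\<close> reduce the expected gap to a quarter.\<close>

definition quarter_reached ::
    "nat \<Rightarrow> (nat \<Rightarrow> 'a::euclidean_space \<Rightarrow> real) \<Rightarrow> ('a \<Rightarrow> real) \<Rightarrow> real \<Rightarrow> real \<Rightarrow> real \<Rightarrow> nat \<Rightarrow>
     'a \<Rightarrow> nat \<Rightarrow> bool" where
  "quarter_reached n \<phi> h \<mu> \<eta> \<omega> m z\<^sub>0 k \<longleftrightarrow>
     (let \<Phi> = finite_sum_objective n \<phi> h; \<Phi>_min = (INF x. \<Phi> x)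
      in expected_value \<Phi> (asvrg n \<phi> h \<mu> \<eta> \<omega> m z\<^sub>0 k) - \<Phi>_min \<le> (\<Phi> z\<^sub>0 - \<Phi>_min) / 4)"

text \<open>This is only meaningful if some \<open>k\<close> satisfies \<open>quarter_reached\<close>.\<close>

definition asvrg_until_quarter ::
    "nat \<Rightarrow> (nat \<Rightarrow> 'a::euclidean_space \<Rightarrow> real) \<Rightarrow> ('a \<Rightarrow> real) \<Rightarrow> real \<Rightarrow> real \<Rightarrow> real \<Rightarrow> nat \<Rightarrow>
     'a \<Rightarrow> ('a \<times> nat) pmf" where
  "asvrg_until_quarter n \<phi> h \<mu> \<eta> \<omega> m z\<^sub>0 =
     asvrg n \<phi> h \<mu> \<eta> \<omega> m z\<^sub>0 (LEAST k. quarter_reached n \<phi> h \<mu> \<eta> \<omega> m z\<^sub>0 k)"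


subsection \<open>Joint adaptive regularization and smoothing\<close>

definition smoothed :: "(nat \<Rightarrow> 'a::euclidean_space \<Rightarrow> real) \<Rightarrow> real \<Rightarrow> nat \<Rightarrow> 'a \<Rightarrow> real" where
  "smoothed f \<delta> i = moreau_envelope \<delta> (f i)"

definition regularized :: "('a::euclidean_space \<Rightarrow> real) \<Rightarrow> 'a \<Rightarrow> real \<Rightarrow> 'a \<Rightarrow> real" where
  "regularized g x\<^sub>0 \<sigma> x = g x + \<sigma> / 2 * (norm (x - x\<^sub>0))\<^sup>2"

text \<open>
  The step size, momentum parameter and epoch length of the base algorithm are functions
  \<open>\<eta>, \<omega>, m\<close> of the number of components, the smoothness constant and the strong convexity constant.
  The result is the distribution of the iterate after \<open>t\<close> rounds, paired with the total number of
  gradient evaluations; round \<open>t\<close> uses \<open>\<delta>\<^sub>0 2\<^sup>t\<close> and \<open>\<sigma>\<^sub>0 / 2\<^sup>t\<close>.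
\<close>

primrec adaptive_asvrg ::
    "nat \<Rightarrow> (nat \<Rightarrow> 'a::euclidean_space \<Rightarrow> real) \<Rightarrow> ('a \<Rightarrow> real) \<Rightarrow>
     (nat \<Rightarrow> real \<Rightarrow> real \<Rightarrow> real) \<Rightarrow> (nat \<Rightarrow> real \<Rightarrow> real \<Rightarrow> real) \<Rightarrow> (nat \<Rightarrow> real \<Rightarrow> real \<Rightarrow> nat) \<Rightarrow>
     real \<Rightarrow> real \<Rightarrow> 'a \<Rightarrow> nat \<Rightarrow> ('a \<times> nat) pmf" where
  "adaptive_asvrg n f g \<eta> \<omega> m \<delta>\<^sub>0 \<sigma>\<^sub>0 x\<^sub>0 0 = return_pmf (x\<^sub>0, 0)"
| "adaptive_asvrg n f g \<eta> \<omega> m \<delta>\<^sub>0 \<sigma>\<^sub>0 x\<^sub>0 (Suc t) =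
     do {
       (x, c) \<leftarrow> adaptive_asvrg n f g \<eta> \<omega> m \<delta>\<^sub>0 \<sigma>\<^sub>0 x\<^sub>0 t;
       let \<delta> = \<delta>\<^sub>0 * 2 ^ t;
       let \<sigma> = \<sigma>\<^sub>0 / 2 ^ t;
       (x', c') \<leftarrow> asvrg_until_quarter n (smoothed f \<delta>) (regularized g x\<^sub>0 \<sigma>)
                   \<sigma> (\<eta> n \<delta> \<sigma>) (\<omega> n \<delta> \<sigma>) (m n \<delta> \<sigma>) x;
       return_pmf (x', c + c')
     }"

text \<open>Every round of the first \<open>T\<close> stops, from every point at which it can be started.\<close>

definition adaptive_asvrg_rounds_stop ::
    "nat \<Rightarrow> (nat \<Rightarrow> 'a::euclidean_space \<Rightarrow> real) \<Rightarrow> ('a \<Rightarrow> real) \<Rightarrow>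
     (nat \<Rightarrow> real \<Rightarrow> real \<Rightarrow> real) \<Rightarrow> (nat \<Rightarrow> real \<Rightarrow> real \<Rightarrow> real) \<Rightarrow> (nat \<Rightarrow> real \<Rightarrow> real \<Rightarrow> nat) \<Rightarrow>
     real \<Rightarrow> real \<Rightarrow> 'a \<Rightarrow> nat \<Rightarrow> bool" where
  "adaptive_asvrg_rounds_stop n f g \<eta> \<omega> m \<delta>\<^sub>0 \<sigma>\<^sub>0 x\<^sub>0 T \<longleftrightarrow>
     (\<forall>t<T. \<forall>(x, c)\<in>set_pmf (adaptive_asvrg n f g \<eta> \<omega> m \<delta>\<^sub>0 \<sigma>\<^sub>0 x\<^sub>0 t).
        let \<delta> = \<delta>\<^sub>0 * 2 ^ t; \<sigma> = \<sigma>\<^sub>0 / 2 ^ t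
        in \<exists>k. quarter_reached n (smoothed f \<delta>) (regularized g x\<^sub>0 \<sigma>)
                 \<sigma> (\<eta> n \<delta> \<sigma>) (\<omega> n \<delta> \<sigma>) (m n \<delta> \<sigma>) x k)"

end

theory Submission
  imports Defs
begin

text \<open>
  Let \<open>u\<close> minimize the objective \<open>\<Phi>\<close>. Averaged over the random index, an ASVRG step from \<open>(x, y)\<close> to
  \<open>(x', y')\<close> with snapshot \<open>z\<close> satisfies \<open>\<Phi> x' + K \<parallel>u - y'\<parallel>\<^sup>2 \<le> (1 - \<omega>) \<Phi> z + \<omega> \<Phi> u + K \<parallel>u - y\<parallel>\<^sup>2\<close>
  where \<open>K = \<omega>\<^sup>2 / (2\<eta>)\<close>: the variance of the gradient estimator is bounded, by
  cocoercivity, by the Bregman distance of \<open>x\<close> and the snapshot \<open>z\<close>, and the bound on \<open>\<omega>\<close> absorbs it. Telescoping over an epoch and over the epochs of a restart,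
  and bounding \<open>\<parallel>u - z\<^sub>0\<parallel>\<^sup>2\<close> by the gap through strong convexity, shows that a restart halves the gap,
  so every round stops after at most two restarts.

  With \<open>\<eta> = 1 / (3 L)\<close>, \<open>m = n\<close> and \<open>\<omega> = min (1/2) (\<surd>(n \<mu> / L) / 2)\<close> a round costs at most
  \<open>30 n + 42 \<surd>(n L / \<mu>)\<close>. If \<open>A\<^sub>t\<close> is the expected value of the \<open>t\<close>-th surrogate objective at the
  \<open>t\<close>-th iterate minus \<open>F x\<^sup>*\<close>, then
  \<open>A\<^sub>t\<^sub>+\<^sub>1 \<le> A\<^sub>t / 4 + 3/8 \<sigma>\<^sub>t D\<^sup>2 + G\<^sup>2 / (2 \<delta>\<^sub>t)\<close>, so \<open>A\<^sub>t \<le> \<Delta> / 2\<^sup>t\<close> for suitable \<open>\<sigma>\<^sub>0\<close> and \<open>\<delta>\<^sub>0\<close>. The condition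
  numbers \<open>\<delta>\<^sub>t / \<sigma>\<^sub>t\<close> grow like \<open>4\<^sup>t\<close>, so the square-root terms form a geometric sum dominated by the
  last round, where \<open>2\<^sup>T\<close> is of order \<open>\<Delta> / \<epsilon>\<close>.
\<close>

section \<open>Proximal points and Moreau envelopes\<close>

lemma norm_diff_split:
  fixes x y p :: "'a::real_inner"
  shows "(norm (y - x))\<^sup>2 = (norm (y - p))\<^sup>2 + 2 * ((y - p) \<bullet> (p - x)) + (norm (p - x))\<^sup>2"
  by (simp add: power2_norm_eq_inner inner_diff_left inner_diff_right inner_commute)

lemma convex_quadratic_minimizer_exists:
  fixes f :: "'a::euclidean_space \<Rightarrow> real"
  assumes f: "convex_on UNIV f" and c: "0 < c"
  shows "\<exists>p. \<forall>y. f p + c / 2 * (norm (p - x))\<^sup>2 \<le> f y + c / 2 * (norm (y - x))\<^sup>2"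
proof -
  have cont: "continuous_on UNIV f"
    using convex_on_continuous[OF open_UNIV f] .
  obtain w where w: "w \<in> cball x 1" "\<And>y. y \<in> cball x 1 \<Longrightarrow> f w \<le> f y"
    using continuous_attains_inf[of "cball x 1" f] continuous_on_subset[OF cont subset_UNIV] by auto
  \<comment> \<open>For \<open>r \<ge> 2 * (f x - f w) / c\<close> the quadratic term at distance
    \<open>r\<close> makes up for the largest possible drop \<open>r * (f x - f w)\<close> of
    \<open>f\<close>.\<close>
  define R where "R = max 1 (2 * (f x - f w) / c)"
  have R1: "1 \<le> R" unfolding R_def by simp
  let ?q = "\<lambda>y. f y + c / 2 * (norm (y - x))\<^sup>2"
  have "continuous_on (cball x R) ?q"
    by (intro continuous_intros continuous_on_subset[OF cont]) auto
  then obtain p where p: "p \<in> cball x R" "\<And>y. y \<in> cball x R \<Longrightarrow> ?q p \<le> ?q y"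
    using continuous_attains_inf[of "cball x R" ?q] R1 by auto
  have "?q p \<le> ?q y" for y
  proof (cases "y \<in> cball x R")
    case False
    define r where "r = norm (y - x)"
    have rR: "r > R" using False by (simp add: r_def dist_norm norm_minus_commute)
    hence r1: "r > 1" using R1 by simp
    \<comment> \<open>The segment from \<open>x\<close> to \<open>y\<close> leaves the unit ball
      around \<open>x\<close> at \<open>y1\<close>; convexity carries the bound
      \<open>f w \<le> f y1\<close> on to \<open>y\<close>.\<close>
    define y1 where "y1 = (1 - 1 / r) *\<^sub>R x + (1 / r) *\<^sub>R y"
    have "y1 - x = (1 / r) *\<^sub>R (y - x)"
      by (simp add: y1_def algebra_simps)
    hence "norm (y1 - x) = 1" using r1 by (auto simp: r_def)
    hence "f w \<le> f y1" using w(2) by (simp add: dist_norm norm_minus_commute)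
    also have "f y1 \<le> (1 - 1 / r) * f x + (1 / r) * f y"
      unfolding y1_def using r1 by (intro convex_onD[OF f]) auto
    finally have "r * f w \<le> r * ((1 - 1 / r) * f x + (1 / r) * f y)"
      using r1 by simp
    also have "\<dots> = (r - 1) * f x + f y" using r1 by (simp add: field_simps)
    finally have fy: "r * (f w - f x) + f x \<le> f y" by (simp add: algebra_simps)
    have "2 * (f x - f w) / c \<le> r" using rR unfolding R_def by simp
    hence "f x - f w \<le> c / 2 * r" using c by (simp add: field_simps)
    hence "r * (f x - f w) \<le> r * (c / 2 * r)" using r1 by (intro mult_left_mono) auto
    hence "f x \<le> ?q y" using fy unfolding r_def[symmetric] by (simp add: algebra_simps power2_eq_square)
    moreover have "?q p \<le> f x" using p(2)[of x] R1 by simp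
    ultimately show ?thesis by simp
  qed (use p in auto)
  thus ?thesis by blast
qed

text \<open>Comparing \<open>p\<close> with the point at fraction \<open>t\<close> of the way to
  \<open>y\<close>, dividing by \<open>t\<close> and letting \<open>t\<close> tend to 0 gives the
  variational inequality \<open>0 \<le> b\<close>. Expanding the square around \<open>p\<close>
  turns it into the claim.\<close>

lemma convex_quadratic_minimizer_growth:
  fixes f :: "'a::real_inner \<Rightarrow> real"
  assumes f: "convex_on UNIV f" and c: "0 < c"
    and p: "\<And>y. f p + c / 2 * (norm (p - x))\<^sup>2 \<le> f y + c / 2 * (norm (y - x))\<^sup>2"
  shows "f p + c / 2 * (norm (p - x))\<^sup>2 + c / 2 * (norm (y - p))\<^sup>2 \<le> f y + c / 2 * (norm (y - x))\<^sup>2"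
proof -
  define b where "b = f y - f p + c * ((y - p) \<bullet> (p - x))"
  have "- (c / 2 * (norm (y - p))\<^sup>2) * t \<le> b" if t: "0 < t" "t < 1" for t
  proof -
    let ?w = "(1 - t) *\<^sub>R p + t *\<^sub>R y"
    have w: "?w - p = t *\<^sub>R (y - p)" by (simp add: algebra_simps)
    have "f ?w \<le> (1 - t) * f p + t * f y"
      using t by (intro convex_onD[OF f]) auto
    hence "f p + c / 2 * (norm (p - x))\<^sup>2 \<le> (1 - t) * f p + t * f y + c / 2 * (norm (?w - x))\<^sup>2"
      using p[of ?w] by simp
    also have "(norm (?w - x))\<^sup>2 = t\<^sup>2 * (norm (y - p))\<^sup>2 + 2 * t * ((y - p) \<bullet> (p - x)) + (norm (p - x))\<^sup>2"
      unfolding norm_diff_split[of ?w x p] w by (simp add: power_mult_distrib)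
    finally have "0 \<le> t * (b + c / 2 * (norm (y - p))\<^sup>2 * t)"
      by (simp add: b_def algebra_simps power2_eq_square)
    thus ?thesis using t by (simp add: zero_le_mult_iff)
  qed
  note bound = this
  have lim: "((\<lambda>t. - (c / 2 * (norm (y - p))\<^sup>2) * t) \<longlongrightarrow> - (c / 2 * (norm (y - p))\<^sup>2) * 0) (at_right 0)"
    by (intro tendsto_intros)
  have ev: "eventually (\<lambda>t. - (c / 2 * (norm (y - p))\<^sup>2) * t \<le> b) (at_right (0::real))"
    unfolding eventually_at_right_field using bound by (intro exI[of _ 1]) auto
  have "0 \<le> b"
    using tendsto_upperbound[OF lim ev] by simp
  thus ?thesis unfolding norm_diff_split[of y x p] b_def by (simp add: algebra_simps)
qed

lemma proximal_point_exists:
  fixes f :: "'a::euclidean_space \<Rightarrow> real"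
  assumes "convex_on UNIV f" and "0 < c"
  obtains p where
    "\<And>y. f p + c / 2 * (norm (p - x))\<^sup>2 + c / 2 * (norm (y - p))\<^sup>2 \<le> f y + c / 2 * (norm (y - x))\<^sup>2"
proof -
  obtain p where p: "\<And>y. f p + c / 2 * (norm (p - x))\<^sup>2 \<le> f y + c / 2 * (norm (y - x))\<^sup>2"
    using convex_quadratic_minimizer_exists[OF assms] by blast
  show thesis
    by (rule that, rule convex_quadratic_minimizer_growth[OF assms p])
qed

section \<open>Smoothness and accuracy of Moreau envelopes\<close>

lemma moreau_envelope_proximal_point:
  fixes f :: "'a::euclidean_space \<Rightarrow> real"
  assumes "0 < \<delta>" and p: "\<And>y. f p + \<delta> / 2 * (norm (p - x))\<^sup>2 + \<delta> / 2 * (norm (y - p))\<^sup>2 \<le>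
    f y + \<delta> / 2 * (norm (y - x))\<^sup>2"
  shows "moreau_envelope \<delta> f x = f p + \<delta> / 2 * (norm (p - x))\<^sup>2"
proof -
  have "f p + \<delta> / 2 * (norm (p - x))\<^sup>2 \<le> f y + \<delta> / 2 * (norm (y - x))\<^sup>2" for y
  proof -
    have "0 \<le> \<delta> / 2 * (norm (y - p))\<^sup>2" using assms(1) by simp
    thus ?thesis using p[of y] by simp
  qed
  thus ?thesis unfolding moreau_envelope_def
    by (intro cInf_eq_minimum) (auto simp: norm_minus_commute)
qed

text \<open>The witness is \<open>\<delta>\<close> times the displacement \<open>x - p x\<close>
  from the proximal point. Using \<open>p x\<close> as a competitor at \<open>z\<close> gives the
  upper bound. Using \<open>p z\<close> as a competitor at \<open>x\<close> gives the lower one,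
  where the growth term at \<open>p x\<close> supplies exactly the cocoercivity term.\<close>

lemma moreau_envelope_two_points:
  fixes f :: "'a::euclidean_space \<Rightarrow> real"
  assumes f: "convex_on UNIV f" and d: "0 < \<delta>"
  shows "\<exists>d. \<forall>x z. moreau_envelope \<delta> f z
          \<le> moreau_envelope \<delta> f x + d x \<bullet> (z - x) + \<delta> / 2 * (norm (z - x))\<^sup>2
      \<and> moreau_envelope \<delta> f x + d x \<bullet> (z - x) + (norm (d x - d z))\<^sup>2 / (2 * \<delta>)
          \<le> moreau_envelope \<delta> f z"
proof -
  have "\<exists>p. \<forall>y. f p + \<delta> / 2 * (norm (p - x))\<^sup>2 + \<delta> / 2 * (norm (y - p))\<^sup>2
          \<le> f y + \<delta> / 2 * (norm (y - x))\<^sup>2" for x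
    by (rule proximal_point_exists[OF assms, of x]) blast
  hence "\<exists>p. \<forall>x y. f (p x) + \<delta> / 2 * (norm (p x - x))\<^sup>2 + \<delta> / 2 * (norm (y - p x))\<^sup>2
          \<le> f y + \<delta> / 2 * (norm (y - x))\<^sup>2"
    by (intro choice) blast
  then obtain p where p: "\<And>x y. f (p x) + \<delta> / 2 * (norm (p x - x))\<^sup>2 + \<delta> / 2 * (norm (y - p x))\<^sup>2
          \<le> f y + \<delta> / 2 * (norm (y - x))\<^sup>2"
    by blast
  note env = moreau_envelope_proximal_point[OF d p]
  define d where "d = (\<lambda>x. \<delta> *\<^sub>R (x - p x))"
  have up: "moreau_envelope \<delta> f z
          \<le> moreau_envelope \<delta> f x + d x \<bullet> (z - x) + \<delta> / 2 * (norm (z - x))\<^sup>2" for x z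
  proof -
    have "moreau_envelope \<delta> f z \<le> f (p x) + \<delta> / 2 * (norm (p x - z))\<^sup>2"
    proof -
      have "0 \<le> \<delta> / 2 * (norm (p x - p z))\<^sup>2" using d by simp
      thus ?thesis using p[of z "p x"] unfolding env by simp
    qed
    also have "\<dots> = moreau_envelope \<delta> f x + d x \<bullet> (z - x) + \<delta> / 2 * (norm (z - x))\<^sup>2"
      unfolding env d_def
      by (simp add: power2_norm_eq_inner inner_diff_left inner_diff_right inner_commute algebra_simps)
    finally show ?thesis .
  qed
  have low: "moreau_envelope \<delta> f x + d x \<bullet> (z - x) + (norm (d x - d z))\<^sup>2 / (2 * \<delta>)
          \<le> moreau_envelope \<delta> f z" for x z
  proof -
    have e: "(norm (d x - d z))\<^sup>2 / (2 * \<delta>) = \<delta> / 2 * (norm ((x - p x) - (z - p z)))\<^sup>2"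
    proof -
      have "norm (d x - d z) = \<delta> * norm ((x - p x) - (z - p z))"
        using assms(2) unfolding d_def scaleR_diff_right[symmetric] norm_scaleR by simp
      thus ?thesis using assms(2) by (simp add: power2_eq_square)
    qed
    have "f (p x) + \<delta> / 2 * (norm (p x - x))\<^sup>2 + \<delta> / 2 * (norm (p z - p x))\<^sup>2
          \<le> f (p z) + \<delta> / 2 * (norm (p z - x))\<^sup>2"
      by (rule p)
    thus ?thesis unfolding env e unfolding d_def
      by (simp add: power2_norm_eq_inner inner_diff_left inner_diff_right inner_commute algebra_simps)
  qed
  from up low show ?thesis by blast
qed

text \<open>The two bounds squeeze the first-order remainder between 0 and a quadratic, so
  \<open>d\<close> is a derivative. As \<open>gradient\<close> is a definite description, uniqueness
  has to be shown too.\<close>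

lemma gradient_eqI:
  assumes "\<And>z. f x + d \<bullet> (z - x) \<le> f z"
    and "\<And>z. f z \<le> f x + d \<bullet> (z - x) + \<delta> / 2 * (norm (z - x))\<^sup>2"
  shows "gradient f x = d"
proof -
  have "GDERIV f x :> d"
    unfolding gderiv_def has_derivative_at
  proof (intro conjI)
    show "bounded_linear (\<lambda>h. h \<bullet> d)" by (rule bounded_linear_inner_left)
    show "(\<lambda>h. norm (f (x + h) - f x - h \<bullet> d) / norm h) \<midarrow>0\<rightarrow> 0"
    proof (rule tendsto_sandwich)
      show "eventually (\<lambda>h. 0 \<le> norm (f (x + h) - f x - h \<bullet> d) / norm h) (at 0)" by simp
      show "eventually (\<lambda>h. norm (f (x + h) - f x - h \<bullet> d) / norm h \<le> \<delta> / 2 * norm h) (at 0)"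
        unfolding eventually_at_topological
      proof (intro exI[of _ UNIV] conjI ballI impI)
        fix h :: 'a assume h: "h \<noteq> 0"
        have "norm (f (x + h) - f x - h \<bullet> d) \<le> \<delta> / 2 * (norm h)\<^sup>2"
          using assms(1)[of "x + h"] assms(2)[of "x + h"] by (simp add: inner_commute)
        thus "norm (f (x + h) - f x - h \<bullet> d) / norm h \<le> \<delta> / 2 * norm h"
          using h by (simp add: field_simps power2_eq_square)
      qed auto
      have "((\<lambda>h::'a. \<delta> / 2 * norm h) \<longlongrightarrow> \<delta> / 2 * norm (0::'a)) (at 0)" by (intro tendsto_intros)
      thus "((\<lambda>h::'a. \<delta> / 2 * norm h) \<longlongrightarrow> 0) (at 0)" by simp
    qed simp
  qed
  moreover have "D = d" if "GDERIV f x :> D" for D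
  proof -
    have "(\<lambda>h. h \<bullet> D) = (\<lambda>h. h \<bullet> d)"
      using that \<open>GDERIV f x :> d\<close> unfolding gderiv_def by (rule has_derivative_unique)
    thus ?thesis by (metis vector_eq_ldot)
  qed
  ultimately show ?thesis unfolding gradient_def by blast
qed

lemma moreau_envelope_smooth:
  fixes f :: "'a::euclidean_space \<Rightarrow> real"
  assumes "convex_on UNIV f" and "0 < \<delta>"
  shows moreau_envelope_upper: "moreau_envelope \<delta> f z
          \<le> moreau_envelope \<delta> f x + gradient (moreau_envelope \<delta> f) x \<bullet> (z - x) + \<delta> / 2 * (norm (z - x))\<^sup>2"
    and moreau_envelope_cocoercive: "moreau_envelope \<delta> f x + gradient (moreau_envelope \<delta> f) x \<bullet> (z - x)
          + (norm (gradient (moreau_envelope \<delta> f) x - gradient (moreau_envelope \<delta> f) z))\<^sup>2 / (2 * \<delta>)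
          \<le> moreau_envelope \<delta> f z"
proof -
  obtain d where d: "\<And>x z. moreau_envelope \<delta> f z
          \<le> moreau_envelope \<delta> f x + d x \<bullet> (z - x) + \<delta> / 2 * (norm (z - x))\<^sup>2"
      "\<And>x z. moreau_envelope \<delta> f x + d x \<bullet> (z - x) + (norm (d x - d z))\<^sup>2 / (2 * \<delta>)
          \<le> moreau_envelope \<delta> f z"
    using moreau_envelope_two_points[OF assms] by blast
  have "moreau_envelope \<delta> f x + d x \<bullet> (z - x) \<le> moreau_envelope \<delta> f z" for x z
  proof -
    have "0 \<le> (norm (d x - d z))\<^sup>2 / (2 * \<delta>)" using assms(2) by simp
    thus ?thesis using d(2)[of x z] by simp
  qed
  hence "gradient (moreau_envelope \<delta> f) = d"
    by (intro ext gradient_eqI[where \<delta> = \<delta>] d(1)) auto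
  thus "moreau_envelope \<delta> f z
          \<le> moreau_envelope \<delta> f x + gradient (moreau_envelope \<delta> f) x \<bullet> (z - x) + \<delta> / 2 * (norm (z - x))\<^sup>2"
    "moreau_envelope \<delta> f x + gradient (moreau_envelope \<delta> f) x \<bullet> (z - x)
          + (norm (gradient (moreau_envelope \<delta> f) x - gradient (moreau_envelope \<delta> f) z))\<^sup>2 / (2 * \<delta>)
          \<le> moreau_envelope \<delta> f z"
    using d by auto
qed

text \<open>In the weighted average of the two subgradient inequalities at the intermediate point
  \<open>?w\<close> the linear terms cancel.\<close>

lemma convex_on_subgradientI:
  fixes f :: "'a::real_inner \<Rightarrow> real"
  assumes "\<And>x z. f x + d x \<bullet> (z - x) \<le> f z"
  shows "convex_on UNIV f"
proof (rule convex_onI)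
  fix t :: real and x y :: 'a
  assume t: "0 < t" "t < 1"
  let ?w = "(1 - t) *\<^sub>R x + t *\<^sub>R y"
  have e: "x - ?w = (- t) *\<^sub>R (y - x)" "y - ?w = (1 - t) *\<^sub>R (y - x)"
    by (simp_all add: algebra_simps)
  have "(1 - t) * (f ?w + d ?w \<bullet> (x - ?w)) + t * (f ?w + d ?w \<bullet> (y - ?w))
    \<le> (1 - t) * f x + t * f y"
    using t by (intro add_mono mult_left_mono assms) auto
  also have "(1 - t) * (f ?w + d ?w \<bullet> (x - ?w)) + t * (f ?w + d ?w \<bullet> (y - ?w)) = f ?w"
    unfolding e by (simp add: algebra_simps)
  finally show "f ?w \<le> (1 - t) * f x + t * f y" .
qed simp

lemma moreau_envelope_le:
  fixes f :: "'a::euclidean_space \<Rightarrow> real"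
  assumes "convex_on UNIV f" and "0 < \<delta>"
  shows "moreau_envelope \<delta> f x \<le> f x"
proof -
  obtain p where p: "\<And>y. f p + \<delta> / 2 * (norm (p - x))\<^sup>2 + \<delta> / 2 * (norm (y - p))\<^sup>2 \<le>
    f y + \<delta> / 2 * (norm (y - x))\<^sup>2"
    using proximal_point_exists[OF assms, of x] by blast
  show ?thesis
  proof -
    have "0 \<le> \<delta> / 2 * (norm (x - p))\<^sup>2" using assms(2) by simp
    thus ?thesis using p[of x] unfolding moreau_envelope_proximal_point[OF assms(2) p] by simp
  qed
qed

text \<open>Moving from \<open>x\<close> to \<open>y\<close> gains at most
  \<open>G * norm (x - y)\<close>, and by Young's inequality the quadratic penalty pays for all of
  this except \<open>G\<^sup>2 / (2 * \<delta>)\<close>.\<close>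

lemma le_moreau_envelope:
  fixes f :: "'a::euclidean_space \<Rightarrow> real"
  assumes G: "G-lipschitz_on UNIV f" and "0 < \<delta>"
  shows "f x \<le> moreau_envelope \<delta> f x + G\<^sup>2 / (2 * \<delta>)"
proof -
  have "f x - G\<^sup>2 / (2 * \<delta>) \<le> f y + \<delta> / 2 * (norm (x - y))\<^sup>2" for y
  proof -
    have "f x - f y \<le> G * norm (x - y)"
      using lipschitz_onD[OF G, of x y] by (simp add: dist_norm)
    moreover have "0 \<le> (G - \<delta> * norm (x - y))\<^sup>2 / (2 * \<delta>)"
      using assms(2) by simp
    hence "G * norm (x - y) \<le> G\<^sup>2 / (2 * \<delta>) + \<delta> / 2 * (norm (x - y))\<^sup>2"
      using assms(2) by (simp add: power2_eq_square field_simps)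
    ultimately show ?thesis by simp
  qed
  hence "f x - G\<^sup>2 / (2 * \<delta>) \<le> moreau_envelope \<delta> f x"
    unfolding moreau_envelope_def by (intro cINF_greatest) auto
  thus ?thesis by simp
qed

text \<open>The price of changing the smoothing parameter between rounds; the comparison goes
  through \<open>f\<close> itself.\<close>

lemma moreau_envelope_mono:
  fixes f :: "'a::euclidean_space \<Rightarrow> real"
  assumes "convex_on UNIV f" and "G-lipschitz_on UNIV f" and "0 < \<delta>" "0 < \<delta>'"
  shows "moreau_envelope \<delta>' f x \<le> moreau_envelope \<delta> f x + G\<^sup>2 / (2 * \<delta>)"
  using moreau_envelope_le[OF assms(1,4), of x] le_moreau_envelope[OF assms(2,3), of x] by simp

section \<open>Expectations of finitely supported distributions\<close>

text \<open>Every distribution produced by the algorithm has finite support, so all integrability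
  conditions are automatic.\<close>

lemma expectation_mono_finite:
  fixes f g :: "'a \<Rightarrow> real"
  assumes "finite (set_pmf p)" and "\<And>x. x \<in> set_pmf p \<Longrightarrow> f x \<le> g x"
  shows "measure_pmf.expectation p f \<le> measure_pmf.expectation p g"
  using assms by (intro integral_mono_AE integrable_measure_pmf_finite) (auto simp: AE_measure_pmf_iff)

lemma expectation_bind_finite:
  fixes f :: "'b \<Rightarrow> real"
  assumes "finite (set_pmf p)" and "\<And>x. x \<in> set_pmf p \<Longrightarrow> finite (set_pmf (q x))"
  shows "measure_pmf.expectation (bind_pmf p q) f
    = measure_pmf.expectation p (\<lambda>x. measure_pmf.expectation (q x) f)"
proof -
  have "measure_pmf.expectation (bind_pmf p q) f
      = (\<Sum>x\<in>set_pmf p. pmf p x *\<^sub>R measure_pmf.expectation (q x) f)"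
    by (rule pmf_expectation_bind) (use assms in auto)
  also have "\<dots> = measure_pmf.expectation p (\<lambda>x. measure_pmf.expectation (q x) f)"
    by (rule integral_measure_pmf[symmetric]) (use assms in auto)
  finally show ?thesis .
qed

lemma expectation_bind_le:
  fixes f :: "'b \<Rightarrow> real"
  assumes "finite (set_pmf p)" and "\<And>x. x \<in> set_pmf p \<Longrightarrow> finite (set_pmf (q x))"
    and "\<And>x. x \<in> set_pmf p \<Longrightarrow> measure_pmf.expectation (q x) f \<le> g x"
  shows "measure_pmf.expectation (bind_pmf p q) f \<le> measure_pmf.expectation p g"
proof -
  have "measure_pmf.expectation (bind_pmf p q) f
      = measure_pmf.expectation p (\<lambda>x. measure_pmf.expectation (q x) f)"
    by (rule expectation_bind_finite) (use assms in auto)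
  also have "\<dots> \<le> measure_pmf.expectation p g"
    by (rule expectation_mono_finite) (use assms in auto)
  finally show ?thesis .
qed

lemma expectation_affine_finite:
  fixes f :: "'a \<Rightarrow> real"
  assumes "finite (set_pmf p)"
  shows "measure_pmf.expectation p (\<lambda>x. c * f x + b) = c * measure_pmf.expectation p f + b"
  using assms by (simp add: integrable_measure_pmf_finite)

text \<open>
  The states of \<^const>\<open>asvrg_inner\<close> and \<^const>\<open>asvrg_epochs\<close> record the sum of the iterates but not
  the sum of their objective values. In the potentials the latter is replaced by its lower bound
  \<open>t f (s / t)\<close>, which is a function of the state. The hypothesis on \<open>s\<close> is due to \<open>s / 0 = 0\<close>.
\<close>

lemma convex_on_add_point_to_mean:
  fixes f :: "'a::real_vector \<Rightarrow> real"
  assumes f: "convex_on UNIV f" and s: "t = 0 \<Longrightarrow> s = 0"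
  shows "real (Suc t) * f ((s + x) /\<^sub>R real (Suc t)) \<le> real t * f (s /\<^sub>R real t) + f x"
proof (cases "t = 0")
  case True
  thus ?thesis using s by simp
next
  case False
  define l where "l = 1 / real (Suc t)"
  have l: "0 \<le> l" "l \<le> 1" unfolding l_def by auto
  have "(s + x) /\<^sub>R real (Suc t) = (1 - l) *\<^sub>R (s /\<^sub>R real t) + l *\<^sub>R x"
    using False by (simp add: l_def divide_simps scaleR_add_right)
  hence "real (Suc t) * f ((s + x) /\<^sub>R real (Suc t))
      = real (Suc t) * f ((1 - l) *\<^sub>R (s /\<^sub>R real t) + l *\<^sub>R x)"
    by simp
  also have "\<dots> \<le> real (Suc t) * ((1 - l) * f (s /\<^sub>R real t) + l * f x)"
    by (intro mult_left_mono convex_onD[OF f l]) auto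
  also have "\<dots> = (real (Suc t) * (1 - l)) * f (s /\<^sub>R real t) + (real (Suc t) * l) * f x"
    by (simp only: distrib_left mult.assoc)
  also have "\<dots> = real t * f (s /\<^sub>R real t) + f x"
  proof -
    have "real (Suc t) * (1 - l) = real t" "real (Suc t) * l = 1"
      by (simp_all add: l_def field_simps)
    thus ?thesis by simp
  qed
  finally show ?thesis .
qed

text \<open>\<open>D\<close> is the mean of the \<open>d i\<close>, and a variance is the second
  moment minus the squared norm of the mean.\<close>

lemma sum_norm_deviation_le:
  fixes d :: "'i \<Rightarrow> 'a::real_inner"
  assumes "finite A" and D: "(\<Sum>i\<in>A. d i) = real (card A) *\<^sub>R D"
  shows "(\<Sum>i\<in>A. (norm (D - d i))\<^sup>2) \<le> (\<Sum>i\<in>A. (norm (d i))\<^sup>2)"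
proof -
  have "(norm (D - d i))\<^sup>2 = (norm (d i))\<^sup>2 - 2 * (d i \<bullet> D) + (norm D)\<^sup>2" for i
    by (simp add: power2_norm_eq_inner inner_diff_left inner_diff_right inner_commute)
  hence "(\<Sum>i\<in>A. (norm (D - d i))\<^sup>2)
      = (\<Sum>i\<in>A. (norm (d i))\<^sup>2) - 2 * ((\<Sum>i\<in>A. d i) \<bullet> D) + real (card A) * (norm D)\<^sup>2"
    by (simp add: sum.distrib sum_subtractf inner_sum_left sum_distrib_left)
  also have "\<dots> = (\<Sum>i\<in>A. (norm (d i))\<^sup>2) - real (card A) * (norm D)\<^sup>2"
    unfolding D by (simp add: power2_norm_eq_inner)
  finally show ?thesis by simp
qed

section \<open>Convergence of ASVRG\<close>

text \<open>With the linear term counted as part of the convex function, this is the growth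
  inequality for a quadratic with coefficient \<open>\<omega> / \<eta>\<close>.\<close>

lemma prox_step_growth:
  fixes h :: "'a::euclidean_space \<Rightarrow> real" and v y u :: 'a
  assumes h: "convex_on UNIV h" and "0 < \<eta>" "0 < \<omega>"
  defines "p \<equiv> prox_step h \<eta> \<omega> v y"
  shows "v \<bullet> (p - y) + \<omega> / (2 * \<eta>) * (norm (p - y))\<^sup>2 + h p + \<omega> / (2 * \<eta>) * (norm (u - p))\<^sup>2
    \<le> v \<bullet> (u - y) + \<omega> / (2 * \<eta>) * (norm (u - y))\<^sup>2 + h u"
proof -
  let ?k = "\<lambda>w. v \<bullet> (w - y) + h w"
  let ?q = "\<lambda>w. v \<bullet> (w - y) + \<omega> / (2 * \<eta>) * (norm (w - y))\<^sup>2 + h w"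
  have c: "0 < \<omega> / \<eta>" using assms by simp
  have k: "convex_on UNIV ?k"
  proof (intro convex_on_add h)
    show "convex_on UNIV (\<lambda>w. v \<bullet> (w - y))"
      by (rule convex_on_subgradientI[where d = "\<lambda>_. v"]) (simp add: inner_diff_right)
  qed
  obtain w where w: "\<forall>z. ?k w + (\<omega> / \<eta>) / 2 * (norm (w - y))\<^sup>2 \<le> ?k z + (\<omega> / \<eta>) / 2 * (norm (z - y))\<^sup>2"
    using convex_quadratic_minimizer_exists[OF k c] by blast
  have half: "\<omega> / \<eta> / 2 = \<omega> / (2 * \<eta>)" by simp
  \<comment> \<open>\<open>ARG_MIN\<close> is a choice operator: only the existence of the minimizer
    \<open>w\<close> guarantees that the chosen \<open>p\<close> is one.\<close>
  have "is_arg_min ?q (\<lambda>_. True) w"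
    using w unfolding is_arg_min_def half by (auto simp: not_less add_ac)
  hence "is_arg_min ?q (\<lambda>_. True) p"
    unfolding p_def prox_step_def arg_min_def by (rule someI)
  hence "?q p \<le> ?q z" for z
    unfolding is_arg_min_def by (auto simp: not_less)
  hence "?k p + (\<omega> / \<eta>) / 2 * (norm (p - y))\<^sup>2 \<le> ?k z + (\<omega> / \<eta>) / 2 * (norm (z - y))\<^sup>2" for z
    unfolding half by (simp add: add_ac)
  from convex_quadratic_minimizer_growth[OF k c this, of u] show ?thesis
    unfolding half by (simp add: add_ac)
qed

section \<open>A single inner step of ASVRG\<close>

locale asvrg_problem =
  fixes n :: nat and \<phi> :: "nat \<Rightarrow> 'a::euclidean_space \<Rightarrow> real" and h :: "'a \<Rightarrow> real"
    and L \<eta> \<omega> :: real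
  assumes n_pos: "1 \<le> n" and L_pos: "0 < L"
    and upper: "\<And>i x z. i \<in> {1..n} \<Longrightarrow>
      \<phi> i z \<le> \<phi> i x + gradient (\<phi> i) x \<bullet> (z - x) + L / 2 * (norm (z - x))\<^sup>2"
    and cocoercive: "\<And>i x z. i \<in> {1..n} \<Longrightarrow>
      \<phi> i x + gradient (\<phi> i) x \<bullet> (z - x) + (norm (gradient (\<phi> i) x - gradient (\<phi> i) z))\<^sup>2 / (2 * L) \<le> \<phi> i z"
    and h_convex: "convex_on UNIV h"
    and \<eta>_pos: "0 < \<eta>" and \<eta>_less: "L * \<eta> < 1" and \<omega>_pos: "0 < \<omega>"
    and \<omega>_le: "\<omega> \<le> 1 - L * \<eta> / (1 - L * \<eta>)"
begin

abbreviation \<Phi> :: "'a \<Rightarrow> real" where "\<Phi> \<equiv> finite_sum_objective n \<phi> h"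

definition smooth_part :: "'a \<Rightarrow> real" where "smooth_part x = (\<Sum>i=1..n. \<phi> i x) / real n"

abbreviation mean_gradient :: "'a \<Rightarrow> 'a" where "mean_gradient \<equiv> full_gradient n \<phi>"

lemma objective_eq: "\<Phi> x = smooth_part x + h x"
  by (simp add: finite_sum_objective_def smooth_part_def)

lemma \<omega>_le_1: "\<omega> \<le> 1"
proof -
  have "0 \<le> L * \<eta> / (1 - L * \<eta>)" using L_pos \<eta>_pos \<eta>_less by simp
  thus ?thesis using \<omega>_le by simp
qed

lemma sum_gradient: "(\<Sum>i=Suc 0..n. gradient (\<phi> i) x) = real n *\<^sub>R mean_gradient x"
  using n_pos by (simp add: full_gradient_def)

lemma smooth_part_upper:
  "smooth_part z \<le> smooth_part x + mean_gradient x \<bullet> (z - x) + L / 2 * (norm (z - x))\<^sup>2"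
proof -
  have "(\<Sum>i=1..n. \<phi> i z)
      \<le> (\<Sum>i=1..n. \<phi> i x + gradient (\<phi> i) x \<bullet> (z - x) + L / 2 * (norm (z - x))\<^sup>2)"
    by (intro sum_mono upper) auto
  also have "\<dots> = (\<Sum>i=1..n. \<phi> i x) + real n * (mean_gradient x \<bullet> (z - x)) + real n * (L / 2 * (norm (z - x))\<^sup>2)"
    by (simp add: sum.distrib inner_sum_left[symmetric] sum_gradient)
  finally show ?thesis using n_pos unfolding smooth_part_def by (simp add: field_simps)
qed

lemma smooth_part_cocoercive:
  "(\<Sum>i=1..n. (norm (gradient (\<phi> i) x - gradient (\<phi> i) z))\<^sup>2)
    \<le> 2 * L * real n * (smooth_part z - smooth_part x - mean_gradient x \<bullet> (z - x))"
proof -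
  have "(\<Sum>i=1..n. \<phi> i x + gradient (\<phi> i) x \<bullet> (z - x)
      + (norm (gradient (\<phi> i) x - gradient (\<phi> i) z))\<^sup>2 / (2 * L)) \<le> (\<Sum>i=1..n. \<phi> i z)"
    by (intro sum_mono cocoercive) auto
  hence "(\<Sum>i=1..n. (norm (gradient (\<phi> i) x - gradient (\<phi> i) z))\<^sup>2) / (2 * L)
      \<le> (\<Sum>i=1..n. \<phi> i z) - (\<Sum>i=1..n. \<phi> i x) - real n * (mean_gradient x \<bullet> (z - x))"
    by (simp add: sum.distrib inner_sum_left[symmetric] sum_gradient sum_divide_distrib[symmetric])
  also have "\<dots> = real n * (smooth_part z - smooth_part x - mean_gradient x \<bullet> (z - x))"
    using n_pos unfolding smooth_part_def by (simp add: field_simps)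
  finally show ?thesis using L_pos by (simp add: field_simps)
qed

lemma smooth_part_lower: "smooth_part x + mean_gradient x \<bullet> (z - x) \<le> smooth_part z"
proof -
  have "0 \<le> 2 * L * real n * (smooth_part z - smooth_part x - mean_gradient x \<bullet> (z - x))"
    using smooth_part_cocoercive[of x z] by (meson order_trans sum_nonneg zero_le_power2)
  moreover have "0 < 2 * L * real n" using n_pos L_pos by simp
  ultimately show ?thesis by (simp only: zero_le_mult_iff) linarith
qed

lemma convex_smooth_part: "convex_on UNIV smooth_part"
  by (rule convex_on_subgradientI[OF smooth_part_lower])

lemma convex_objective: "convex_on UNIV \<Phi>"
  using convex_on_add[OF convex_smooth_part h_convex] by (simp add: objective_eq[abs_def])

text \<open>An inner step is written as a function of the drawn index, so that the expectation over
  the index becomes an average over \<open>{1..n}\<close>.\<close>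

definition step_direction :: "'a \<Rightarrow> 'a \<Rightarrow> nat \<Rightarrow> 'a" where
  "step_direction x z i = gradient (\<phi> i) x - gradient (\<phi> i) z + mean_gradient z"

definition step_y :: "'a \<Rightarrow> 'a \<Rightarrow> 'a \<Rightarrow> nat \<Rightarrow> 'a" where
  "step_y x y z i = prox_step h \<eta> \<omega> (step_direction x z i) y"

definition step_x :: "'a \<Rightarrow> 'a \<Rightarrow> 'a \<Rightarrow> nat \<Rightarrow> 'a" where
  "step_x x y z i = z + \<omega> *\<^sub>R (step_y x y z i - z)"

lemma sum_step_direction: "(\<Sum>i=Suc 0..n. step_direction x z i) = real n *\<^sub>R mean_gradient x"
  by (simp add: step_direction_def sum.distrib sum_subtractf sum_gradient sum_constant_scaleR)

text \<open>The error of the estimator is the deviation of the gradient difference of component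
  \<open>i\<close> from its mean. Its second moment is controlled by cocoercivity, which yields the
  Bregman distance between the snapshot \<open>z\<close> and \<open>x\<close>.\<close>

lemma step_variance:
  "(\<Sum>i=1..n. (norm (mean_gradient x - step_direction x z i))\<^sup>2)
    \<le> 2 * L * real n * (smooth_part z - smooth_part x - mean_gradient x \<bullet> (z - x))"
proof -
  have "(\<Sum>i=1..n. (norm ((mean_gradient x - mean_gradient z) - (gradient (\<phi> i) x - gradient (\<phi> i) z)))\<^sup>2)
     \<le> (\<Sum>i=1..n. (norm (gradient (\<phi> i) x - gradient (\<phi> i) z))\<^sup>2)"
    by (rule sum_norm_deviation_le) (simp_all add: sum_subtractf sum_gradient scaleR_diff_right)
  moreover have "(mean_gradient x - mean_gradient z) - (gradient (\<phi> i) x - gradient (\<phi> i) z)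
      = mean_gradient x - step_direction x z i" for i
    by (simp add: step_direction_def)
  ultimately show ?thesis using smooth_part_cocoercive[of x z] by simp
qed

text \<open>For a fixed index, four estimates are added: smoothness at \<open>x\<close>, Young's
  inequality to replace the exact gradient by the estimator, optimality of the proximal step scaled
  by \<open>\<omega>\<close>, and convexity of \<open>h\<close>.\<close>

lemma step_bound:
  assumes x: "x = z + \<omega> *\<^sub>R (y - z)"
  shows "\<Phi> (step_x x y z i) + \<omega>\<^sup>2 / (2 * \<eta>) * (norm (u - step_y x y z i))\<^sup>2
    \<le> smooth_part x + (norm (mean_gradient x - step_direction x z i))\<^sup>2 / (2 * (1 / \<eta> - L))
      + \<omega> * (step_direction x z i \<bullet> (u - y)) + \<omega> * h u + (1 - \<omega>) * h z
      + \<omega>\<^sup>2 / (2 * \<eta>) * (norm (u - y))\<^sup>2"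
proof -
  define v where "v = step_direction x z i"
  define y' where "y' = step_y x y z i"
  define x' where "x' = step_x x y z i"
  define w where "w = x' - x"
  define e where "e = mean_gradient x - v"
  \<comment> \<open>The parameter of Young's inequality, chosen such that
    \<open>b / 2 + L / 2 = 1 / (2 * \<eta>)\<close>: both quadratic terms in \<open>w\<close>
    together are cancelled by the one from the proximal step.\<close>
  define b where "b = 1 / \<eta> - L"
  have b: "0 < b" using \<eta>_less \<eta>_pos unfolding b_def by (simp add: field_simps)
  have w: "w = \<omega> *\<^sub>R (y' - y)"
    unfolding w_def x'_def step_x_def y'_def x by (simp add: algebra_simps)
  have 1: "smooth_part x' \<le> smooth_part x + mean_gradient x \<bullet> w + L / 2 * (norm w)\<^sup>2"
    unfolding w_def by (rule smooth_part_upper)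
  have "0 \<le> (norm (e - b *\<^sub>R w))\<^sup>2 / (2 * b)" using b by simp
  also have "(norm (e - b *\<^sub>R w))\<^sup>2 = (norm e)\<^sup>2 - 2 * b * (e \<bullet> w) + b\<^sup>2 * (norm w)\<^sup>2"
    unfolding power2_norm_eq_inner
    by (simp add: inner_diff_left inner_diff_right inner_commute power2_eq_square algebra_simps)
  also have "\<dots> / (2 * b) = (norm e)\<^sup>2 / (2 * b) - e \<bullet> w + b / 2 * (norm w)\<^sup>2"
    using b by (simp add: field_simps power2_eq_square)
  finally have 2: "mean_gradient x \<bullet> w \<le> v \<bullet> w + (norm e)\<^sup>2 / (2 * b) + b / 2 * (norm w)\<^sup>2"
    unfolding e_def by (simp add: inner_diff_left)
  have "v \<bullet> (y' - y) + \<omega> / (2 * \<eta>) * (norm (y' - y))\<^sup>2 + h y' + \<omega> / (2 * \<eta>) * (norm (u - y'))\<^sup>2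
    \<le> v \<bullet> (u - y) + \<omega> / (2 * \<eta>) * (norm (u - y))\<^sup>2 + h u"
    unfolding y'_def step_y_def v_def by (rule prox_step_growth[OF h_convex \<eta>_pos \<omega>_pos])
  hence "\<omega> * (v \<bullet> (y' - y) + \<omega> / (2 * \<eta>) * (norm (y' - y))\<^sup>2 + h y' + \<omega> / (2 * \<eta>) * (norm (u - y'))\<^sup>2)
    \<le> \<omega> * (v \<bullet> (u - y) + \<omega> / (2 * \<eta>) * (norm (u - y))\<^sup>2 + h u)"
    using \<omega>_pos by (intro mult_left_mono) auto
  hence 3: "v \<bullet> w + (norm w)\<^sup>2 / (2 * \<eta>) + \<omega> * h y' + \<omega>\<^sup>2 / (2 * \<eta>) * (norm (u - y'))\<^sup>2
    \<le> \<omega> * (v \<bullet> (u - y)) + \<omega>\<^sup>2 / (2 * \<eta>) * (norm (u - y))\<^sup>2 + \<omega> * h u"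
    using \<omega>_pos unfolding w by (simp add: distrib_left power2_eq_square mult_ac)
  have "x' = (1 - \<omega>) *\<^sub>R z + \<omega> *\<^sub>R y'"
    unfolding x'_def step_x_def y'_def by (simp add: algebra_simps)
  hence 4: "h x' \<le> (1 - \<omega>) * h z + \<omega> * h y'"
    using convex_onD[OF h_convex, of \<omega> z y'] \<omega>_pos \<omega>_le_1 by simp
  have "b / 2 * (norm w)\<^sup>2 + L / 2 * (norm w)\<^sup>2 = (norm w)\<^sup>2 / (2 * \<eta>)"
    unfolding b_def by (simp add: field_simps)
  with 1 2 3 4 show ?thesis
    unfolding objective_eq x'_def[symmetric] y'_def[symmetric] v_def[symmetric] e_def[symmetric] b_def[symmetric]
    by linarith
qed

lemma mean_step_bound:
  assumes x: "x = z + \<omega> *\<^sub>R (y - z)"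
  shows "(\<Sum>i=1..n. \<Phi> (step_x x y z i) + \<omega>\<^sup>2 / (2 * \<eta>) * (norm (u - step_y x y z i))\<^sup>2) / real n
    \<le> (1 - \<omega>) * \<Phi> z + \<omega> * \<Phi> u + \<omega>\<^sup>2 / (2 * \<eta>) * (norm (u - y))\<^sup>2"
proof -
  \<comment> \<open>\<open>\<rho>\<close> is the factor of the Bregman distance \<open>Bz\<close> in
    the averaged variance term. The admissibility condition on \<open>\<omega>\<close> says
    precisely that \<open>\<rho> \<le> 1 - \<omega>\<close>.\<close>
  define \<rho> where "\<rho> = L * \<eta> / (1 - L * \<eta>)"
  define b where "b = 1 / \<eta> - L"
  define Bz where "Bz = smooth_part z - smooth_part x - mean_gradient x \<bullet> (z - x)"
  have b: "0 < b" using \<eta>_less \<eta>_pos unfolding b_def by (simp add: field_simps)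
  have Lb: "L / b = \<rho>" using \<eta>_less \<eta>_pos unfolding b_def \<rho>_def by (simp add: divide_simps)
  have Bz0: "0 \<le> Bz" unfolding Bz_def using smooth_part_lower[of x z] by simp
  have "(\<Sum>i=1..n. \<Phi> (step_x x y z i) + \<omega>\<^sup>2 / (2 * \<eta>) * (norm (u - step_y x y z i))\<^sup>2)
    \<le> (\<Sum>i=1..n. smooth_part x + (norm (mean_gradient x - step_direction x z i))\<^sup>2 / (2 * b)
      + \<omega> * (step_direction x z i \<bullet> (u - y)) + \<omega> * h u + (1 - \<omega>) * h z
      + \<omega>\<^sup>2 / (2 * \<eta>) * (norm (u - y))\<^sup>2)"
    unfolding b_def by (intro sum_mono step_bound x)
  also have "\<dots> = (\<Sum>i=1..n. (norm (mean_gradient x - step_direction x z i))\<^sup>2) / (2 * b)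
      + real n * (smooth_part x + \<omega> * (mean_gradient x \<bullet> (u - y)) + \<omega> * h u + (1 - \<omega>) * h z
      + \<omega>\<^sup>2 / (2 * \<eta>) * (norm (u - y))\<^sup>2)"
    by (simp add: sum.distrib sum_distrib_left[symmetric] sum_divide_distrib[symmetric]
        inner_sum_left[symmetric] sum_step_direction)
      (simp add: algebra_simps)
  also have "(\<Sum>i=1..n. (norm (mean_gradient x - step_direction x z i))\<^sup>2) / (2 * b)
      \<le> (2 * L * real n * Bz) / (2 * b)"
    using step_variance[of x z] b unfolding Bz_def by (intro divide_right_mono) auto
  also have "(2 * L * real n * Bz) / (2 * b) = real n * (\<rho> * Bz)"
    unfolding Lb[symmetric] by simp
  finally have main: "(\<Sum>i=1..n. \<Phi> (step_x x y z i) + \<omega>\<^sup>2 / (2 * \<eta>) * (norm (u - step_y x y z i))\<^sup>2) / real n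
    \<le> \<rho> * Bz + (smooth_part x + \<omega> * (mean_gradient x \<bullet> (u - y)) + \<omega> * h u + (1 - \<omega>) * h z
      + \<omega>\<^sup>2 / (2 * \<eta>) * (norm (u - y))\<^sup>2)"
    using n_pos by (simp add: field_simps)
  \<comment> \<open>By the coupling of \<open>x\<close>, \<open>y\<close> and \<open>z\<close> the
    linear term splits into a part towards \<open>u\<close>, bounded by convexity, and a part
    towards \<open>z\<close>, which cancels the linear part of
    \<open>(1 - \<omega>) * Bz\<close>.\<close>
  have "\<omega> *\<^sub>R (u - y) = \<omega> *\<^sub>R (u - x) + (1 - \<omega>) *\<^sub>R (z - x)"
    unfolding x by (simp add: algebra_simps)
  hence "\<omega> * (mean_gradient x \<bullet> (u - y))
      = \<omega> * (mean_gradient x \<bullet> (u - x)) + (1 - \<omega>) * (mean_gradient x \<bullet> (z - x))"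
    by (metis inner_add_right inner_scaleR_right)
  moreover have "\<omega> * (mean_gradient x \<bullet> (u - x)) \<le> \<omega> * (smooth_part u - smooth_part x)"
    using smooth_part_lower[of x u] \<omega>_pos by (intro mult_left_mono) auto
  moreover have "\<rho> * Bz \<le> (1 - \<omega>) * Bz"
    using \<omega>_le Bz0 unfolding \<rho>_def by (intro mult_right_mono) auto
  ultimately have "\<rho> * Bz + smooth_part x + \<omega> * (mean_gradient x \<bullet> (u - y))
      \<le> (1 - \<omega>) * Bz + smooth_part x + \<omega> * (smooth_part u - smooth_part x)
        + (1 - \<omega>) * (mean_gradient x \<bullet> (z - x))"
    by linarith
  also have "\<dots> = \<omega> * smooth_part u + (1 - \<omega>) * smooth_part z"
    unfolding Bz_def by (simp add: algebra_simps)
  finally show ?thesis using main unfolding objective_eq by (simp add: algebra_simps)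
qed

section \<open>Epochs, restarts and the stopping rule\<close>

lemma finite_asvrg_inner: "finite (set_pmf (asvrg_inner n \<phi> h \<eta> \<omega> z v x y t))"
  using n_pos by (induction t) (auto simp: Let_def set_bind_pmf split: prod.splits)

lemma finite_asvrg_epochs: "finite (set_pmf (asvrg_epochs n \<phi> h \<eta> \<omega> m z k))"
  by (induction k) (auto simp: Let_def set_bind_pmf finite_asvrg_inner split: prod.splits)

lemma finite_asvrg: "finite (set_pmf (asvrg n \<phi> h \<mu> \<eta> \<omega> m z k))"
  by (induction k) (auto simp: Let_def set_bind_pmf finite_asvrg_epochs split: prod.splits)

text \<open>The coupling of \<open>x\<close> and \<open>y\<close> is what
  \<open>mean_step_bound\<close> asks for, the counter gives the cost, and the last clause covers
  the mean of zero iterates.\<close>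

lemma asvrg_inner_invariant:
  assumes "x\<^sub>0 = z + \<omega> *\<^sub>R (y\<^sub>0 - z)"
    and "(x, y, s, c) \<in> set_pmf (asvrg_inner n \<phi> h \<eta> \<omega> z v x\<^sub>0 y\<^sub>0 t)"
  shows "x = z + \<omega> *\<^sub>R (y - z)" "c = 2 * t" "t = 0 \<Longrightarrow> s = 0"
proof -
  have "x = z + \<omega> *\<^sub>R (y - z) \<and> c = 2 * t \<and> (t = 0 \<longrightarrow> s = 0)"
    using assms(2)
    by (induction t arbitrary: x y s c) (use assms(1) in \<open>auto simp: Let_def\<close>)
  thus "x = z + \<omega> *\<^sub>R (y - z)" "c = 2 * t" "t = 0 \<Longrightarrow> s = 0" by auto
qed

lemma asvrg_epochs_invariant:
  assumes "(z, x, y, a, c) \<in> set_pmf (asvrg_epochs n \<phi> h \<eta> \<omega> m z\<^sub>0 k)"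
  shows "x = z + \<omega> *\<^sub>R (y - z)" "c = k * (n + 2 * m)" "k = 0 \<Longrightarrow> a = 0"
proof -
  have "x = z + \<omega> *\<^sub>R (y - z) \<and> c = k * (n + 2 * m) \<and> (k = 0 \<longrightarrow> a = 0)"
    using assms
  proof (induction k arbitrary: z x y a c)
    case (Suc k)
    from Suc.prems obtain z1 x1 y1 a1 c1 x' y' s c' where
      1: "(z1, x1, y1, a1, c1) \<in> set_pmf (asvrg_epochs n \<phi> h \<eta> \<omega> m z\<^sub>0 k)"
      and 2: "(x', y', s, c') \<in> set_pmf (asvrg_inner n \<phi> h \<eta> \<omega> z1 (mean_gradient z1) x1 y1 m)"
      and 3: "z = s /\<^sub>R real m" "x = (1 - \<omega>) *\<^sub>R z + \<omega> *\<^sub>R y'" "y = y'" "c = c1 + n + c'"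
      by (auto simp: Let_def)
    have "x1 = z1 + \<omega> *\<^sub>R (y1 - z1)" "c1 = k * (n + 2 * m)" using Suc.IH[OF 1] by auto
    thus ?case using asvrg_inner_invariant(2)[OF _ 2] 3 by (simp add: algebra_simps)
  qed auto
  thus "x = z + \<omega> *\<^sub>R (y - z)" "c = k * (n + 2 * m)" "k = 0 \<Longrightarrow> a = 0" by auto
qed

text \<open>The distance terms telescope, and every step adds the same constant because the snapshot
  \<open>z\<close> stays fixed during an epoch.\<close>

lemma asvrg_inner_bound:
  fixes u :: 'a
  assumes x0: "x\<^sub>0 = z + \<omega> *\<^sub>R (y\<^sub>0 - z)"
  shows "measure_pmf.expectation (asvrg_inner n \<phi> h \<eta> \<omega> z (mean_gradient z) x\<^sub>0 y\<^sub>0 t)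
      (\<lambda>(x, y, s, c). real t * \<Phi> (s /\<^sub>R real t) + \<omega>\<^sup>2 / (2 * \<eta>) * (norm (u - y))\<^sup>2)
    \<le> real t * ((1 - \<omega>) * \<Phi> z + \<omega> * \<Phi> u) + \<omega>\<^sup>2 / (2 * \<eta>) * (norm (u - y\<^sub>0))\<^sup>2"
proof (induction t)
  case (Suc t)
  define K where "K = \<omega>\<^sup>2 / (2 * \<eta>)"
  define B where "B = (1 - \<omega>) * \<Phi> z + \<omega> * \<Phi> u"
  let ?p = "asvrg_inner n \<phi> h \<eta> \<omega> z (mean_gradient z) x\<^sub>0 y\<^sub>0 t"
  let ?f = "\<lambda>(x, y, s, c). real (Suc t) * \<Phi> (s /\<^sub>R real (Suc t)) + K * (norm (u - y))\<^sup>2"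
  let ?g = "\<lambda>(x, y, s, c). real t * \<Phi> (s /\<^sub>R real t) + K * (norm (u - y))\<^sup>2"
  define q where "q = (\<lambda>st. case st of (x, y, s, c) \<Rightarrow> pmf_of_set {1..n} \<bind> (\<lambda>i.
      return_pmf (step_x x y z i, step_y x y z i, s + step_x x y z i, c + (2::nat))))"
  have "asvrg_inner n \<phi> h \<eta> \<omega> z (mean_gradient z) x\<^sub>0 y\<^sub>0 (Suc t) = ?p \<bind> q"
    unfolding q_def by (simp add: Let_def step_x_def step_y_def step_direction_def)
  \<comment> \<open>The factor 1 gives the bound the shape required by
    \<open>expectation_affine_finite\<close>.\<close>
  moreover have "measure_pmf.expectation (?p \<bind> q) ?f \<le> measure_pmf.expectation ?p (\<lambda>st. 1 * ?g st + B)"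
  proof (rule expectation_bind_le[OF finite_asvrg_inner])
    fix st assume st: "st \<in> set_pmf ?p"
    obtain x y s c where st_eq: "st = (x, y, s, c)" by (cases st)
    note inv = asvrg_inner_invariant[OF x0 st[unfolded st_eq]]
    show "finite (set_pmf (q st))" using n_pos by (simp add: q_def st_eq)
    have "measure_pmf.expectation (q st) ?f = (\<Sum>i=1..n. real (Suc t) * \<Phi> ((s + step_x x y z i) /\<^sub>R real (Suc t))
        + K * (norm (u - step_y x y z i))\<^sup>2) / real n"
      unfolding q_def st_eq using n_pos
      by (simp add: expectation_bind_finite integral_pmf_of_set del: of_nat_Suc)
    also have "\<dots> \<le> (\<Sum>i=1..n. real t * \<Phi> (s /\<^sub>R real t) + (\<Phi> (step_x x y z i)
        + K * (norm (u - step_y x y z i))\<^sup>2)) / real n"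
      using convex_on_add_point_to_mean[OF convex_objective inv(3)]
      by (intro divide_right_mono sum_mono) (auto simp: add.assoc[symmetric] simp del: of_nat_Suc)
    also have "\<dots> = real t * \<Phi> (s /\<^sub>R real t) + (\<Sum>i=1..n. \<Phi> (step_x x y z i)
        + K * (norm (u - step_y x y z i))\<^sup>2) / real n"
      using n_pos unfolding sum.distrib[of "\<lambda>_. real t * \<Phi> (s /\<^sub>R real t)"] by (simp add: add_divide_distrib)
    also have "\<dots> \<le> real t * \<Phi> (s /\<^sub>R real t) + (B + K * (norm (u - y))\<^sup>2)"
      unfolding B_def K_def by (intro add_left_mono mean_step_bound inv)
    finally show "measure_pmf.expectation (q st) ?f \<le> 1 * ?g st + B"
      by (simp add: st_eq)
  qed
  moreover have "measure_pmf.expectation ?p (\<lambda>st. 1 * ?g st + B) = measure_pmf.expectation ?p ?g + B"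
    unfolding expectation_affine_finite[OF finite_asvrg_inner] by simp
  ultimately have "measure_pmf.expectation (asvrg_inner n \<phi> h \<eta> \<omega> z (mean_gradient z) x\<^sub>0 y\<^sub>0 (Suc t)) ?f
      \<le> measure_pmf.expectation ?p ?g + B"
    by (simp only:)
  moreover have "measure_pmf.expectation ?p ?g \<le> real t * B + K * (norm (u - y\<^sub>0))\<^sup>2"
    using Suc.IH unfolding K_def B_def .
  moreover have "real (Suc t) * B = real t * B + B"
    by (simp add: algebra_simps)
  ultimately show ?case unfolding K_def[symmetric] B_def[symmetric] by linarith
qed simp

lemma asvrg_inner_mean_bound:
  fixes u :: 'a
  assumes x0: "x\<^sub>0 = z + \<omega> *\<^sub>R (y\<^sub>0 - z)" and m: "1 \<le> m"
  shows "measure_pmf.expectation (asvrg_inner n \<phi> h \<eta> \<omega> z (mean_gradient z) x\<^sub>0 y\<^sub>0 m)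
      (\<lambda>(x, y, s, c). \<Phi> (s /\<^sub>R real m) + \<omega>\<^sup>2 / (2 * \<eta> * real m) * (norm (u - y))\<^sup>2)
    \<le> (1 - \<omega>) * \<Phi> z + \<omega> * \<Phi> u + \<omega>\<^sup>2 / (2 * \<eta> * real m) * (norm (u - y\<^sub>0))\<^sup>2"
proof -
  let ?p = "asvrg_inner n \<phi> h \<eta> \<omega> z (mean_gradient z) x\<^sub>0 y\<^sub>0 m"
  let ?f = "\<lambda>(x, y, s, c). real m * \<Phi> (s /\<^sub>R real m) + \<omega>\<^sup>2 / (2 * \<eta>) * (norm (u - y))\<^sup>2"
  have "(\<lambda>(x :: 'a, y, s, c :: nat). \<Phi> (s /\<^sub>R real m) + \<omega>\<^sup>2 / (2 * \<eta> * real m) * (norm (u - y))\<^sup>2)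
      = (\<lambda>st. (1 / real m) * ?f st + 0)"
    using m \<eta>_pos by (auto simp: fun_eq_iff field_simps)
  hence "measure_pmf.expectation ?p
      (\<lambda>(x, y, s, c). \<Phi> (s /\<^sub>R real m) + \<omega>\<^sup>2 / (2 * \<eta> * real m) * (norm (u - y))\<^sup>2)
      = measure_pmf.expectation ?p (\<lambda>st. (1 / real m) * ?f st + 0)"
    by (simp only:)
  also have "\<dots> = (1 / real m) * measure_pmf.expectation ?p ?f"
    unfolding expectation_affine_finite[OF finite_asvrg_inner] by (rule add_0_right)
  also have "\<dots> \<le> (1 / real m) * (real m * ((1 - \<omega>) * \<Phi> z + \<omega> * \<Phi> u) + \<omega>\<^sup>2 / (2 * \<eta>) * (norm (u - y\<^sub>0))\<^sup>2)"
    by (intro mult_left_mono asvrg_inner_bound x0) auto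
  also have "\<dots> = (1 - \<omega>) * \<Phi> z + \<omega> * \<Phi> u + \<omega>\<^sup>2 / (2 * \<eta> * real m) * (norm (u - y\<^sub>0))\<^sup>2"
    using m \<eta>_pos by (simp add: field_simps)
  finally show ?thesis .
qed

text \<open>The value at the new snapshot is split: a share \<open>\<omega>\<close> goes into the
  running average, and the share \<open>1 - \<omega>\<close> pays for the snapshot term of the next
  epoch. The distance terms telescope across epochs because \<open>y\<close> is carried
  over.\<close>

lemma asvrg_epochs_bound:
  fixes u :: 'a
  assumes m: "1 \<le> m"
  shows "measure_pmf.expectation (asvrg_epochs n \<phi> h \<eta> \<omega> m z\<^sub>0 k)
      (\<lambda>(z, x, y, a, c). \<omega> * (real k * \<Phi> (a /\<^sub>R real k)) + (1 - \<omega>) * \<Phi> z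
        + \<omega>\<^sup>2 / (2 * \<eta> * real m) * (norm (u - y))\<^sup>2)
    \<le> \<omega> * (real k * \<Phi> u) + (1 - \<omega>) * \<Phi> z\<^sub>0 + \<omega>\<^sup>2 / (2 * \<eta> * real m) * (norm (u - z\<^sub>0))\<^sup>2"
proof (induction k)
  case (Suc k)
  define K where "K = \<omega>\<^sup>2 / (2 * \<eta> * real m)"
  let ?p = "asvrg_epochs n \<phi> h \<eta> \<omega> m z\<^sub>0 k"
  let ?f = "\<lambda>(z, x, y, a, c). \<omega> * (real (Suc k) * \<Phi> (a /\<^sub>R real (Suc k))) + (1 - \<omega>) * \<Phi> z
        + K * (norm (u - y))\<^sup>2"
  let ?g = "\<lambda>(z, x, y, a, c). \<omega> * (real k * \<Phi> (a /\<^sub>R real k)) + (1 - \<omega>) * \<Phi> z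
        + K * (norm (u - y))\<^sup>2"
  define r where "r = (\<lambda>(z :: 'a, x :: 'a, y :: 'a, a :: 'a, c :: nat). \<lambda>(x' :: 'a, y', s, c').
     (s /\<^sub>R real m, (1 - \<omega>) *\<^sub>R (s /\<^sub>R real m) + \<omega> *\<^sub>R y', y', a + s /\<^sub>R real m, c + n + (c'::nat)))"
  define q where "q = (\<lambda>st :: 'a \<times> 'a \<times> 'a \<times> 'a \<times> nat. case st of (z, x, y, a, c) \<Rightarrow>
      asvrg_inner n \<phi> h \<eta> \<omega> z (mean_gradient z) x y m \<bind> (\<lambda>w. return_pmf (r (z, x, y, a, c) w)))"
  have "asvrg_epochs n \<phi> h \<eta> \<omega> m z\<^sub>0 (Suc k) = ?p \<bind> q"
    unfolding q_def r_def by (simp add: Let_def split_def)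
  moreover have "measure_pmf.expectation (?p \<bind> q) ?f \<le> measure_pmf.expectation ?p (\<lambda>st. 1 * ?g st + \<omega> * \<Phi> u)"
  proof (rule expectation_bind_le[OF finite_asvrg_epochs])
    fix st assume st: "st \<in> set_pmf ?p"
    obtain z x y a c where st_eq: "st = (z, x, y, a, c)" by (cases st)
    note inv = asvrg_epochs_invariant[OF st[unfolded st_eq]]
    let ?i = "asvrg_inner n \<phi> h \<eta> \<omega> z (mean_gradient z) x y m"
    let ?e = "\<lambda>(x, y, s, c). \<Phi> (s /\<^sub>R real m) + K * (norm (u - y))\<^sup>2"
    show "finite (set_pmf (q st))" by (simp add: q_def st_eq finite_asvrg_inner)
    have "measure_pmf.expectation (q st) ?f = measure_pmf.expectation ?i (\<lambda>w. ?f (r st w))"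
      unfolding q_def st_eq by (simp add: expectation_bind_finite finite_asvrg_inner)
    also have "\<dots> \<le> measure_pmf.expectation ?i (\<lambda>w. 1 * ?e w + \<omega> * (real k * \<Phi> (a /\<^sub>R real k)))"
    proof (rule expectation_mono_finite[OF finite_asvrg_inner])
      fix w :: "'a \<times> 'a \<times> 'a \<times> nat"
      obtain x' y' s c' where w: "w = (x', y', s, c')" by (cases w)
      have "\<omega> * (real (Suc k) * \<Phi> ((a + s /\<^sub>R real m) /\<^sub>R real (Suc k)))
          \<le> \<omega> * (real k * \<Phi> (a /\<^sub>R real k) + \<Phi> (s /\<^sub>R real m))"
        using \<omega>_pos by (intro mult_left_mono convex_on_add_point_to_mean convex_objective inv) auto
      thus "?f (r st w) \<le> 1 * ?e w + \<omega> * (real k * \<Phi> (a /\<^sub>R real k))"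
        unfolding r_def st_eq w by (simp add: algebra_simps)
    qed
    also have "\<dots> = measure_pmf.expectation ?i ?e + \<omega> * (real k * \<Phi> (a /\<^sub>R real k))"
      unfolding expectation_affine_finite[OF finite_asvrg_inner] by simp
    also have "measure_pmf.expectation ?i ?e \<le> (1 - \<omega>) * \<Phi> z + \<omega> * \<Phi> u + K * (norm (u - y))\<^sup>2"
      unfolding K_def by (intro asvrg_inner_mean_bound m inv)
    finally show "measure_pmf.expectation (q st) ?f \<le> 1 * ?g st + \<omega> * \<Phi> u"
      by (simp add: st_eq)
  qed
  moreover have "measure_pmf.expectation ?p (\<lambda>st. 1 * ?g st + \<omega> * \<Phi> u) = measure_pmf.expectation ?p ?g + \<omega> * \<Phi> u"
    unfolding expectation_affine_finite[OF finite_asvrg_epochs] by simp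
  ultimately have "measure_pmf.expectation (asvrg_epochs n \<phi> h \<eta> \<omega> m z\<^sub>0 (Suc k)) ?f
      \<le> measure_pmf.expectation ?p ?g + \<omega> * \<Phi> u"
    by (simp only:)
  moreover have "measure_pmf.expectation ?p ?g
      \<le> \<omega> * (real k * \<Phi> u) + (1 - \<omega>) * \<Phi> z\<^sub>0 + K * (norm (u - z\<^sub>0))\<^sup>2"
    using Suc.IH unfolding K_def .
  moreover have "\<omega> * (real (Suc k) * \<Phi> u) = \<omega> * (real k * \<Phi> u) + \<omega> * \<Phi> u"
    by (simp add: algebra_simps)
  ultimately show ?case unfolding K_def[symmetric] by linarith
qed simp

lemma asvrg_epochs_gap:
  fixes u :: 'a
  assumes m: "1 \<le> m" and \<mu>: "0 < \<mu>"
    and growth: "\<And>x. \<Phi> u + \<mu> / 2 * (norm (x - u))\<^sup>2 \<le> \<Phi> x"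
  defines "S \<equiv> epochs_per_restart \<eta> \<omega> m \<mu>"
  shows "measure_pmf.expectation (asvrg_epochs n \<phi> h \<eta> \<omega> m z\<^sub>0 S) (\<lambda>(z, x, y, a, c). \<Phi> (a /\<^sub>R real S)) - \<Phi> u
    \<le> (\<Phi> z\<^sub>0 - \<Phi> u) / 2"
proof -
  define K where "K = \<omega>\<^sup>2 / (2 * \<eta> * real m)"
  \<comment> \<open>The first summand stems from the initial snapshot term, the second from the
    initial distance, bounded by \<open>2 / \<mu>\<close> times the gap. A restart takes at least
    \<open>2 * R\<close> epochs, whence the factor 1/2.\<close>
  define R where "R = (1 - \<omega>) / \<omega> + \<omega> / (\<eta> * real m * \<mu>)"
  let ?p = "asvrg_epochs n \<phi> h \<eta> \<omega> m z\<^sub>0 S"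
  let ?A = "\<lambda>(z, x, y, a, c). \<Phi> (a /\<^sub>R real S)"
  have K: "0 \<le> K" using \<eta>_pos by (simp add: K_def)
  have R: "0 < R" unfolding R_def using \<omega>_pos \<omega>_le_1 \<eta>_pos m \<mu>
    by (intro add_nonneg_pos divide_nonneg_pos divide_pos_pos mult_pos_pos) auto
  have S: "2 * R \<le> real S" unfolding S_def epochs_per_restart_def R_def by linarith
  have S0: "0 < real S" using S R by linarith
  have min: "\<Phi> u \<le> \<Phi> x" for x
  proof -
    have "0 \<le> \<mu> / 2 * (norm (x - u))\<^sup>2" using \<mu> by simp
    thus ?thesis using growth[of x] by linarith
  qed
  have gap: "0 \<le> \<Phi> z\<^sub>0 - \<Phi> u" using min[of z\<^sub>0] by simp
  have "\<omega> * real S * measure_pmf.expectation ?p ?A + (1 - \<omega>) * \<Phi> u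
      = measure_pmf.expectation ?p (\<lambda>st. (\<omega> * real S) * ?A st + (1 - \<omega>) * \<Phi> u)"
    by (rule expectation_affine_finite[OF finite_asvrg_epochs, symmetric])
  also have "\<dots> \<le> measure_pmf.expectation ?p (\<lambda>(z, x, y, a, c). \<omega> * (real S * \<Phi> (a /\<^sub>R real S))
      + (1 - \<omega>) * \<Phi> z + K * (norm (u - y))\<^sup>2)"
  proof (rule expectation_mono_finite[OF finite_asvrg_epochs])
    fix st :: "'a \<times> 'a \<times> 'a \<times> 'a \<times> nat"
    obtain z x y a c where st_eq: "st = (z, x, y, a, c)" by (cases st)
    \<comment> \<open>The last snapshot and the final distance are discarded by minimality of
      \<open>u\<close> and nonnegativity.\<close>
    have "(1 - \<omega>) * \<Phi> u \<le> (1 - \<omega>) * \<Phi> z" using min \<omega>_le_1 by (intro mult_left_mono) auto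
    moreover have "0 \<le> K * (norm (u - y))\<^sup>2" using K by simp
    ultimately show "(\<omega> * real S) * ?A st + (1 - \<omega>) * \<Phi> u \<le> (case st of (z, x, y, a, c) \<Rightarrow>
        \<omega> * (real S * \<Phi> (a /\<^sub>R real S)) + (1 - \<omega>) * \<Phi> z + K * (norm (u - y))\<^sup>2)"
      by (simp add: st_eq)
  qed
  also have "\<dots> \<le> \<omega> * (real S * \<Phi> u) + (1 - \<omega>) * \<Phi> z\<^sub>0 + K * (norm (u - z\<^sub>0))\<^sup>2"
    unfolding K_def by (rule asvrg_epochs_bound[OF m])
  also have "K * (norm (u - z\<^sub>0))\<^sup>2 \<le> K * (2 / \<mu> * (\<Phi> z\<^sub>0 - \<Phi> u))"
    using growth[of z\<^sub>0] \<mu> K by (intro mult_left_mono) (auto simp: norm_minus_commute field_simps)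
  also have "\<omega> * (real S * \<Phi> u) + (1 - \<omega>) * \<Phi> z\<^sub>0 + K * (2 / \<mu> * (\<Phi> z\<^sub>0 - \<Phi> u))
      = \<omega> * (real S * \<Phi> u) + (1 - \<omega>) * \<Phi> u + \<omega> * R * (\<Phi> z\<^sub>0 - \<Phi> u)"
    using \<omega>_pos \<eta>_pos \<mu> m unfolding K_def R_def by (simp add: field_simps power2_eq_square)
  finally have "\<omega> * (real S * (measure_pmf.expectation ?p ?A - \<Phi> u)) \<le> \<omega> * (R * (\<Phi> z\<^sub>0 - \<Phi> u))"
    by (simp add: algebra_simps)
  hence "real S * (measure_pmf.expectation ?p ?A - \<Phi> u) \<le> R * (\<Phi> z\<^sub>0 - \<Phi> u)"
    using \<omega>_pos by simp
  also have "\<dots> \<le> (real S / 2) * (\<Phi> z\<^sub>0 - \<Phi> u)"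
    using S gap by (intro mult_right_mono) auto
  also have "\<dots> = real S * ((\<Phi> z\<^sub>0 - \<Phi> u) / 2)" by simp
  finally show ?thesis using S0 by simp
qed

text \<open>A restart halves the gap from every starting point, hence also conditionally on the
  random outcome of the previous restarts.\<close>

lemma asvrg_gap:
  fixes u :: 'a
  assumes m: "1 \<le> m" and \<mu>: "0 < \<mu>"
    and growth: "\<And>x. \<Phi> u + \<mu> / 2 * (norm (x - u))\<^sup>2 \<le> \<Phi> x"
  shows "expected_value \<Phi> (asvrg n \<phi> h \<mu> \<eta> \<omega> m z\<^sub>0 k) - \<Phi> u \<le> (\<Phi> z\<^sub>0 - \<Phi> u) / 2 ^ k"
proof (induction k)
  case (Suc k)
  define S where "S = epochs_per_restart \<eta> \<omega> m \<mu>"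
  let ?p = "asvrg n \<phi> h \<mu> \<eta> \<omega> m z\<^sub>0 k"
  let ?f = "\<lambda>(x, c::nat). \<Phi> x"
  define q where "q = (\<lambda>(z, c). asvrg_epochs n \<phi> h \<eta> \<omega> m z S \<bind>
      (\<lambda>w. return_pmf (case w of (_, _, _, a, c') \<Rightarrow> (a /\<^sub>R real S, c + c'))))"
  have "asvrg n \<phi> h \<mu> \<eta> \<omega> m z\<^sub>0 (Suc k) = ?p \<bind> q"
    unfolding q_def by (simp add: Let_def split_def S_def)
  moreover have "measure_pmf.expectation (?p \<bind> q) ?f
      \<le> measure_pmf.expectation ?p (\<lambda>st. (1 / 2) * ?f st + \<Phi> u / 2)"
  proof (rule expectation_bind_le[OF finite_asvrg])
    fix st :: "'a \<times> nat"
    obtain z c where st_eq: "st = (z, c)" by (cases st)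
    show "finite (set_pmf (q st))" by (simp add: q_def st_eq finite_asvrg_epochs)
    have "measure_pmf.expectation (q st) ?f
        = measure_pmf.expectation (asvrg_epochs n \<phi> h \<eta> \<omega> m z S) (\<lambda>(z, x, y, a, c). \<Phi> (a /\<^sub>R real S))"
      unfolding q_def st_eq by (simp add: expectation_bind_finite finite_asvrg_epochs split_def)
    also have "\<dots> \<le> \<Phi> u + (\<Phi> z - \<Phi> u) / 2"
      using asvrg_epochs_gap[OF m \<mu> growth, of z] unfolding S_def by linarith
    finally show "measure_pmf.expectation (q st) ?f \<le> (1 / 2) * ?f st + \<Phi> u / 2"
      by (simp add: st_eq field_simps)
  qed
  moreover have "measure_pmf.expectation ?p (\<lambda>st. (1 / 2) * ?f st + \<Phi> u / 2)
      = (1 / 2) * expected_value \<Phi> ?p + \<Phi> u / 2"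
    unfolding expectation_affine_finite[OF finite_asvrg] expected_value_def by simp
  ultimately have "expected_value \<Phi> (asvrg n \<phi> h \<mu> \<eta> \<omega> m z\<^sub>0 (Suc k)) \<le> (1 / 2) * expected_value \<Phi> ?p + \<Phi> u / 2"
    unfolding expected_value_def by simp
  hence "expected_value \<Phi> (asvrg n \<phi> h \<mu> \<eta> \<omega> m z\<^sub>0 (Suc k)) - \<Phi> u \<le> (expected_value \<Phi> ?p - \<Phi> u) / 2"
    by (simp add: field_simps del: asvrg.simps)
  also have "\<dots> \<le> (\<Phi> z\<^sub>0 - \<Phi> u) / 2 ^ k / 2"
    using Suc.IH by (intro divide_right_mono) auto
  finally show ?case by (simp add: mult.commute del: asvrg.simps)
qed (simp add: expected_value_def)

lemma asvrg_cost:
  assumes "(z, c) \<in> set_pmf (asvrg n \<phi> h \<mu> \<eta> \<omega> m z\<^sub>0 k)"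
  shows "c = k * (epochs_per_restart \<eta> \<omega> m \<mu> * (n + 2 * m))"
  using assms
proof (induction k arbitrary: z c)
  case (Suc k)
  then obtain z1 c1 z' x' y' a c' where
    1: "(z1, c1) \<in> set_pmf (asvrg n \<phi> h \<mu> \<eta> \<omega> m z\<^sub>0 k)"
    and 2: "(z', x', y', a, c') \<in> set_pmf (asvrg_epochs n \<phi> h \<eta> \<omega> m z1 (epochs_per_restart \<eta> \<omega> m \<mu>))"
    and 3: "c = c1 + c'"
    by (auto simp: Let_def)
  show ?case using Suc.IH[OF 1] asvrg_epochs_invariant(2)[OF 2] 3 by simp
qed simp

lemma quarter_reached_iff:
  assumes "\<And>x. \<Phi> u \<le> \<Phi> x"
  shows "quarter_reached n \<phi> h \<mu> \<eta> \<omega> m z\<^sub>0 k \<longleftrightarrow>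
    expected_value \<Phi> (asvrg n \<phi> h \<mu> \<eta> \<omega> m z\<^sub>0 k) - \<Phi> u \<le> (\<Phi> z\<^sub>0 - \<Phi> u) / 4"
proof -
  have "(INF x. \<Phi> x) = \<Phi> u"
    using assms by (intro cInf_eq_minimum) auto
  thus ?thesis unfolding quarter_reached_def by (simp add: Let_def)
qed

text \<open>Two halvings make a quarter, so the least sufficient number of restarts exists and is at
  most 2. The bound on the expected value is the stopping rule itself, and the cost of a restart is
  deterministic.\<close>

lemma asvrg_until_quarter_correct:
  assumes m: "1 \<le> m" and \<mu>: "0 < \<mu>"
    and growth: "\<And>x. \<Phi> u + \<mu> / 2 * (norm (x - u))\<^sup>2 \<le> \<Phi> x"
  shows "quarter_reached n \<phi> h \<mu> \<eta> \<omega> m z\<^sub>0 2"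
    and "finite (set_pmf (asvrg_until_quarter n \<phi> h \<mu> \<eta> \<omega> m z\<^sub>0))"
    and "4 * expected_value \<Phi> (asvrg_until_quarter n \<phi> h \<mu> \<eta> \<omega> m z\<^sub>0) \<le> \<Phi> z\<^sub>0 + 3 * \<Phi> u"
    and "(z, c) \<in> set_pmf (asvrg_until_quarter n \<phi> h \<mu> \<eta> \<omega> m z\<^sub>0) \<Longrightarrow>
      c \<le> 2 * (epochs_per_restart \<eta> \<omega> m \<mu> * (n + 2 * m))"
proof -
  have min: "\<Phi> u \<le> \<Phi> x" for x
  proof -
    have "0 \<le> \<mu> / 2 * (norm (x - u))\<^sup>2" using \<mu> by simp
    thus ?thesis using growth[of x] by linarith
  qed
  note iff = quarter_reached_iff[OF min]
  define k where "k = (LEAST k. quarter_reached n \<phi> h \<mu> \<eta> \<omega> m z\<^sub>0 k)"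
  show two: "quarter_reached n \<phi> h \<mu> \<eta> \<omega> m z\<^sub>0 2"
    using asvrg_gap[OF assms, of z\<^sub>0 2] unfolding iff by simp
  show "finite (set_pmf (asvrg_until_quarter n \<phi> h \<mu> \<eta> \<omega> m z\<^sub>0))"
    by (simp add: asvrg_until_quarter_def finite_asvrg)
  have "quarter_reached n \<phi> h \<mu> \<eta> \<omega> m z\<^sub>0 k"
    unfolding k_def using two by (rule LeastI)
  thus "4 * expected_value \<Phi> (asvrg_until_quarter n \<phi> h \<mu> \<eta> \<omega> m z\<^sub>0) \<le> \<Phi> z\<^sub>0 + 3 * \<Phi> u"
    unfolding iff asvrg_until_quarter_def k_def[symmetric] by simp
  have "k \<le> 2" unfolding k_def using two by (rule Least_le)
  show "c \<le> 2 * (epochs_per_restart \<eta> \<omega> m \<mu> * (n + 2 * m))"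
    if "(z, c) \<in> set_pmf (asvrg_until_quarter n \<phi> h \<mu> \<eta> \<omega> m z\<^sub>0)"
  proof -
    have "c = k * (epochs_per_restart \<eta> \<omega> m \<mu> * (n + 2 * m))"
      using that unfolding asvrg_until_quarter_def k_def[symmetric] by (rule asvrg_cost)
    thus ?thesis using \<open>k \<le> 2\<close> by (simp del: mult.assoc)
  qed
qed

end

section \<open>Joint adaptive regularization and smoothing\<close>

text \<open>With this step size \<open>L * \<eta> / (1 - L * \<eta>)\<close> equals 1/2, so every
  positive momentum up to 1/2 is admissible.\<close>

definition asvrg_step_size :: "nat \<Rightarrow> real \<Rightarrow> real \<Rightarrow> real" where
  "asvrg_step_size n L \<mu> = 1 / (3 * L)"

text \<open>The second argument of \<open>min\<close> balances, up to constants, the terms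
  \<open>1 / \<omega>\<close> and \<open>3 * \<omega> * L / (real n * \<mu>)\<close> in the restart
  length; the first keeps the momentum admissible.\<close>

definition asvrg_momentum :: "nat \<Rightarrow> real \<Rightarrow> real \<Rightarrow> real" where
  "asvrg_momentum n L \<mu> = min (1 / 2) (sqrt (real n * \<mu> / L) / 2)"

definition asvrg_epoch_length :: "nat \<Rightarrow> real \<Rightarrow> real \<Rightarrow> nat" where
  "asvrg_epoch_length n L \<mu> = n"

lemma asvrg_parameters_admissible:
  assumes "1 \<le> n" "0 < L" "0 < \<mu>"
  shows "asvrg_admissible L (asvrg_step_size n L \<mu>) (asvrg_momentum n L \<mu>) (asvrg_epoch_length n L \<mu>)"
proof -
  have "0 < sqrt (real n * \<mu> / L)" using assms by simp
  moreover have "L * (1 / (3 * L)) = 1 / 3" using assms by simp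
  ultimately show ?thesis using assms
    unfolding asvrg_admissible_def asvrg_step_size_def asvrg_momentum_def asvrg_epoch_length_def
    by (simp add: field_simps)
qed

lemma epochs_per_restart_le:
  assumes n: "1 \<le> n" and L: "0 < L" and \<mu>: "0 < \<mu>"
  shows "real (epochs_per_restart (asvrg_step_size n L \<mu>) (asvrg_momentum n L \<mu>) n \<mu>)
    \<le> 5 + 7 * sqrt (L / (real n * \<mu>))"
proof -
  define r where "r = sqrt (L / (real n * \<mu>))"
  define w where "w = asvrg_momentum n L \<mu>"
  have r: "0 < r" using assms by (simp add: r_def)
  have r2: "r\<^sup>2 = L / (real n * \<mu>)" using assms by (simp add: r_def)
  have "sqrt (real n * \<mu> / L) = 1 / r" by (simp add: r_def real_sqrt_divide real_sqrt_mult)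
  hence w: "w = min (1 / 2) (1 / (2 * r))" by (simp add: w_def asvrg_momentum_def)
  define R where "R = 2 * ((1 - w) / w + w / (asvrg_step_size n L \<mu> * real n * \<mu>))"
  have "w / (asvrg_step_size n L \<mu> * real n * \<mu>) = 3 * w * r\<^sup>2"
    unfolding r2 asvrg_step_size_def using assms by simp
  hence R: "R = 2 * ((1 - w) / w + 3 * w * r\<^sup>2)" by (simp add: R_def)
  have "R \<le> 4 + 7 * r"
  \<comment> \<open>For \<open>r \<le> 1\<close> the cap 1/2 is active, otherwise the balanced value
    \<open>1 / (2 * r)\<close>. Rounding up then raises the constant 4 to 5.\<close>
  proof (cases "r \<le> 1")
    case True
    hence w2: "w = 1 / 2" using r by (simp add: w min_def field_simps)
    have "R = 2 + 3 * r\<^sup>2" unfolding R w2 by simp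
    also have "r\<^sup>2 \<le> 1 * r" using True r unfolding power2_eq_square by (intro mult_right_mono) auto
    finally show ?thesis using r by simp
  next
    case False
    hence w2: "w = 1 / (2 * r)" using r by (simp add: w min_def field_simps)
    have "R = 7 * r - 2" unfolding R w2 using r by (simp add: field_simps power2_eq_square)
    thus ?thesis by simp
  qed
  moreover have "0 \<le> R" unfolding R using r
    by (intro mult_nonneg_nonneg add_nonneg_nonneg divide_nonneg_nonneg) (auto simp: w min_def)
  ultimately show ?thesis
    unfolding epochs_per_restart_def w_def[symmetric] R_def[symmetric] r_def[symmetric] by linarith
qed

text \<open>At most two restarts, with \<open>3 * n\<close> evaluations per epoch, give the factor
  \<open>6 * n\<close> in front of the restart length.\<close>

lemma asvrg_round_cost_le:
  assumes n: "1 \<le> n" and L: "0 < L" and \<mu>: "0 < \<mu>"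
  shows "real (2 * (epochs_per_restart (asvrg_step_size n L \<mu>) (asvrg_momentum n L \<mu>) n \<mu> * (n + 2 * n)))
    \<le> 30 * real n + 42 * sqrt (real n) * sqrt (L / \<mu>)"
proof -
  have "real n * sqrt (L / (real n * \<mu>)) = (sqrt (real n) * sqrt (real n)) * (sqrt (L / \<mu>) / sqrt (real n))"
    by (simp add: real_sqrt_divide real_sqrt_mult)
  also have "\<dots> = sqrt (real n) * sqrt (L / \<mu>)"
    using n by (simp del: real_sqrt_mult_self)
  finally have e: "real n * sqrt (L / (real n * \<mu>)) = sqrt (real n) * sqrt (L / \<mu>)" .
  have "real (2 * (epochs_per_restart (asvrg_step_size n L \<mu>) (asvrg_momentum n L \<mu>) n \<mu> * (n + 2 * n)))
      = 6 * real n * real (epochs_per_restart (asvrg_step_size n L \<mu>) (asvrg_momentum n L \<mu>) n \<mu>)"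
    by simp
  also have "\<dots> \<le> 6 * real n * (5 + 7 * sqrt (L / (real n * \<mu>)))"
    by (intro mult_left_mono epochs_per_restart_le assms) auto
  also have "\<dots> = 30 * real n + 42 * (real n * sqrt (L / (real n * \<mu>)))"
    by (simp add: algebra_simps)
  finally show ?thesis unfolding e by simp
qed

section \<open>The surrogate objectives\<close>

lemma asvrg_problem_smoothed:
  fixes f :: "nat \<Rightarrow> 'a::euclidean_space \<Rightarrow> real"
  assumes "1 \<le> n" "\<And>i. i \<in> {1..n} \<Longrightarrow> convex_on UNIV (f i)" "convex_on UNIV h" "0 < \<delta>"
    and "asvrg_admissible \<delta> \<eta> \<omega> m"
  shows "asvrg_problem n (smoothed f \<delta>) h \<delta> \<eta> \<omega>"
proof
  have "\<eta> < 1 / \<delta>" using assms(5) by (simp add: asvrg_admissible_def)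
  thus "\<delta> * \<eta> < 1" using assms(4) by (simp add: field_simps)
  fix i x z assume i: "i \<in> {1..n}"
  show "smoothed f \<delta> i z \<le> smoothed f \<delta> i x + gradient (smoothed f \<delta> i) x \<bullet> (z - x)
      + \<delta> / 2 * (norm (z - x))\<^sup>2"
    unfolding smoothed_def by (rule moreau_envelope_upper[OF assms(2)[OF i] assms(4)])
  show "smoothed f \<delta> i x + gradient (smoothed f \<delta> i) x \<bullet> (z - x)
      + (norm (gradient (smoothed f \<delta> i) x - gradient (smoothed f \<delta> i) z))\<^sup>2 / (2 * \<delta>) \<le> smoothed f \<delta> i z"
    unfolding smoothed_def by (rule moreau_envelope_cocoercive[OF assms(2)[OF i] assms(4)])
qed (use assms in \<open>auto simp: asvrg_admissible_def\<close>)

lemma convex_on_regularized: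
  fixes g :: "'a::euclidean_space \<Rightarrow> real"
  assumes "convex_on UNIV g" "0 < \<sigma>"
  shows "convex_on UNIV (regularized g x\<^sub>0 \<sigma>)"
proof -
  have "convex_on UNIV (\<lambda>x. \<sigma> / 2 * (norm (x - x\<^sub>0))\<^sup>2)"
  proof (rule convex_on_subgradientI)
    fix x z :: 'a
    have "0 \<le> \<sigma> / 2 * (norm (z - x))\<^sup>2" using assms(2) by simp
    thus "\<sigma> / 2 * (norm (x - x\<^sub>0))\<^sup>2 + (\<sigma> *\<^sub>R (x - x\<^sub>0)) \<bullet> (z - x) \<le> \<sigma> / 2 * (norm (z - x\<^sub>0))\<^sup>2"
      unfolding norm_diff_split[of z x\<^sub>0 x] by (simp add: algebra_simps inner_commute)
  qed
  from convex_on_add[OF assms(1) this] show ?thesis by (simp add: regularized_def[abs_def])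
qed

lemma finite_sum_objective_regularized:
  "finite_sum_objective n \<phi> (regularized g x\<^sub>0 \<sigma>) x = finite_sum_objective n \<phi> g x + \<sigma> / 2 * (norm (x - x\<^sub>0))\<^sup>2"
  by (simp add: finite_sum_objective_def regularized_def)

locale finite_sum_lipschitz =
  fixes n :: nat and f :: "nat \<Rightarrow> 'a::euclidean_space \<Rightarrow> real" and g :: "'a \<Rightarrow> real" and G :: real
    and x\<^sub>0 :: 'a
  assumes n_pos: "1 \<le> n"
    and f_convex: "\<And>i. i \<in> {1..n} \<Longrightarrow> convex_on UNIV (f i)"
    and f_lipschitz: "\<And>i. i \<in> {1..n} \<Longrightarrow> G-lipschitz_on UNIV (f i)"
    and g_convex: "convex_on UNIV g"
begin

abbreviation F :: "'a \<Rightarrow> real" where "F \<equiv> finite_sum_objective n f g"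

abbreviation F_smooth :: "real \<Rightarrow> real \<Rightarrow> 'a \<Rightarrow> real" where
  "F_smooth \<delta> \<sigma> \<equiv> finite_sum_objective n (smoothed f \<delta>) (regularized g x\<^sub>0 \<sigma>)"

lemma finite_sum_objective_mono:
  assumes "\<And>i. i \<in> {1..n} \<Longrightarrow> \<phi> i x \<le> \<psi> i x + b"
  shows "finite_sum_objective n \<phi> g x \<le> finite_sum_objective n \<psi> g x + b"
proof -
  have "(\<Sum>i=1..n. \<phi> i x) \<le> (\<Sum>i=1..n. \<psi> i x + b)"
    by (intro sum_mono assms)
  also have "\<dots> = (\<Sum>i=1..n. \<psi> i x) + real n * b" by (simp add: sum.distrib)
  finally have "(\<Sum>i=1..n. \<phi> i x) / real n \<le> ((\<Sum>i=1..n. \<psi> i x) + real n * b) / real n"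
    by (rule divide_right_mono) simp
  thus ?thesis using n_pos by (simp add: finite_sum_objective_def add_divide_distrib)
qed

lemma F_smooth_le: "0 < \<delta> \<Longrightarrow> F_smooth \<delta> \<sigma> x \<le> F x + \<sigma> / 2 * (norm (x - x\<^sub>0))\<^sup>2"
  using finite_sum_objective_mono[of "smoothed f \<delta>" x f 0] moreau_envelope_le[OF f_convex]
  by (simp add: finite_sum_objective_regularized smoothed_def)

lemma F_le_F_smooth:
  assumes "0 < \<delta>" "0 \<le> \<sigma>"
  shows "F x \<le> F_smooth \<delta> \<sigma> x + G\<^sup>2 / (2 * \<delta>)"
proof -
  have "F x \<le> finite_sum_objective n (smoothed f \<delta>) g x + G\<^sup>2 / (2 * \<delta>)"
    unfolding smoothed_def
    by (intro finite_sum_objective_mono le_moreau_envelope f_lipschitz assms)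
  moreover have "0 \<le> \<sigma> / 2 * (norm (x - x\<^sub>0))\<^sup>2" using assms(2) by simp
  ultimately show ?thesis unfolding finite_sum_objective_regularized by linarith
qed

text \<open>Lowering the regularization can only decrease the objective; changing the smoothing
  costs at most the smoothing error of the old parameter.\<close>

lemma F_smooth_change:
  assumes "0 < \<delta>" "0 < \<delta>'" "\<sigma>' \<le> \<sigma>"
  shows "F_smooth \<delta>' \<sigma>' x \<le> F_smooth \<delta> \<sigma> x + G\<^sup>2 / (2 * \<delta>)"
proof -
  have "finite_sum_objective n (smoothed f \<delta>') g x \<le> finite_sum_objective n (smoothed f \<delta>) g x + G\<^sup>2 / (2 * \<delta>)"
    unfolding smoothed_def
    by (intro finite_sum_objective_mono moreau_envelope_mono f_convex f_lipschitz assms)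
  moreover have "\<sigma>' / 2 * (norm (x - x\<^sub>0))\<^sup>2 \<le> \<sigma> / 2 * (norm (x - x\<^sub>0))\<^sup>2"
    using assms(3) by (intro mult_right_mono) auto
  ultimately show ?thesis unfolding finite_sum_objective_regularized by linarith
qed

section \<open>One round and the whole run\<close>

definition asvrg_round :: "real \<Rightarrow> real \<Rightarrow> 'a \<Rightarrow> ('a \<times> nat) pmf" where
  "asvrg_round \<delta> \<sigma> x = asvrg_until_quarter n (smoothed f \<delta>) (regularized g x\<^sub>0 \<sigma>) \<sigma>
     (asvrg_step_size n \<delta> \<sigma>) (asvrg_momentum n \<delta> \<sigma>) (asvrg_epoch_length n \<delta> \<sigma>) x"

lemma asvrg_round_correct:
  fixes u x :: 'a
  assumes \<delta>: "0 < \<delta>" and \<sigma>: "0 < \<sigma>"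
  shows "quarter_reached n (smoothed f \<delta>) (regularized g x\<^sub>0 \<sigma>) \<sigma>
      (asvrg_step_size n \<delta> \<sigma>) (asvrg_momentum n \<delta> \<sigma>) (asvrg_epoch_length n \<delta> \<sigma>) x 2"
    and "finite (set_pmf (asvrg_round \<delta> \<sigma> x))"
    and "expected_value (F_smooth \<delta> \<sigma>) (asvrg_round \<delta> \<sigma> x)
      \<le> F_smooth \<delta> \<sigma> x / 4 + 3 / 4 * (F u + \<sigma> / 2 * (norm (u - x\<^sub>0))\<^sup>2)"
    and "(z, c) \<in> set_pmf (asvrg_round \<delta> \<sigma> x) \<Longrightarrow>
      real c \<le> 30 * real n + 42 * sqrt (real n) * sqrt (\<delta> / \<sigma>)"
proof -
  note adm = asvrg_parameters_admissible[OF n_pos \<delta> \<sigma>]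
  \<comment> \<open>\<open>P\<close>, with the unregularized \<open>g\<close>, only provides
    convexity of the smoothed objective. Its proximal point at \<open>x\<^sub>0\<close> is then the
    minimizer \<open>p\<close> of the regularized problem \<open>Q\<close>, with the quadratic
    growth that the convergence result requires.\<close>
  interpret P: asvrg_problem n "smoothed f \<delta>" g \<delta> "asvrg_step_size n \<delta> \<sigma>" "asvrg_momentum n \<delta> \<sigma>"
    by (rule asvrg_problem_smoothed[OF n_pos f_convex g_convex \<delta> adm])
  interpret Q: asvrg_problem n "smoothed f \<delta>" "regularized g x\<^sub>0 \<sigma>" \<delta> "asvrg_step_size n \<delta> \<sigma>" "asvrg_momentum n \<delta> \<sigma>"
    by (rule asvrg_problem_smoothed[OF n_pos f_convex convex_on_regularized[OF g_convex \<sigma>] \<delta> adm])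
  obtain p where p: "\<And>y. F_smooth \<delta> \<sigma> p + \<sigma> / 2 * (norm (y - p))\<^sup>2 \<le> F_smooth \<delta> \<sigma> y"
    unfolding finite_sum_objective_regularized
    using proximal_point_exists[OF P.convex_objective \<sigma>, of x\<^sub>0] by blast
  have m: "1 \<le> asvrg_epoch_length n \<delta> \<sigma>" using n_pos by (simp add: asvrg_epoch_length_def)
  note correct = Q.asvrg_until_quarter_correct[OF m \<sigma> p, folded asvrg_round_def]
  show "quarter_reached n (smoothed f \<delta>) (regularized g x\<^sub>0 \<sigma>) \<sigma>
      (asvrg_step_size n \<delta> \<sigma>) (asvrg_momentum n \<delta> \<sigma>) (asvrg_epoch_length n \<delta> \<sigma>) x 2"
    and "finite (set_pmf (asvrg_round \<delta> \<sigma> x))"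
    by (rule correct)+
  \<comment> \<open>The unknown minimal surrogate value is replaced by the surrogate at the
    comparison point \<open>u\<close>, which lies below \<open>F u\<close> plus the
    regularizer.\<close>
  have "0 \<le> \<sigma> / 2 * (norm (u - p))\<^sup>2" using \<sigma> by simp
  hence "F_smooth \<delta> \<sigma> p \<le> F u + \<sigma> / 2 * (norm (u - x\<^sub>0))\<^sup>2"
    using p[of u] F_smooth_le[OF \<delta>, of \<sigma> u] by linarith
  hence "3 / 4 * F_smooth \<delta> \<sigma> p \<le> 3 / 4 * (F u + \<sigma> / 2 * (norm (u - x\<^sub>0))\<^sup>2)"
    by (rule mult_left_mono) simp
  thus "expected_value (F_smooth \<delta> \<sigma>) (asvrg_round \<delta> \<sigma> x)
      \<le> F_smooth \<delta> \<sigma> x / 4 + 3 / 4 * (F u + \<sigma> / 2 * (norm (u - x\<^sub>0))\<^sup>2)"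
    using correct(3)[of x] by linarith
  show "real c \<le> 30 * real n + 42 * sqrt (real n) * sqrt (\<delta> / \<sigma>)"
    if "(z, c) \<in> set_pmf (asvrg_round \<delta> \<sigma> x)"
  proof -
    have "real c \<le> real (2 * (epochs_per_restart (asvrg_step_size n \<delta> \<sigma>) (asvrg_momentum n \<delta> \<sigma>) n \<sigma> * (n + 2 * n)))"
      using correct(4)[OF that] unfolding asvrg_epoch_length_def of_nat_le_iff .
    also have "\<dots> \<le> 30 * real n + 42 * sqrt (real n) * sqrt (\<delta> / \<sigma>)"
      by (rule asvrg_round_cost_le[OF n_pos \<delta> \<sigma>])
    finally show ?thesis .
  qed
qed

abbreviation adaptive :: "real \<Rightarrow> real \<Rightarrow> nat \<Rightarrow> ('a \<times> nat) pmf" where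
  "adaptive d s t \<equiv> adaptive_asvrg n f g asvrg_step_size asvrg_momentum asvrg_epoch_length d s x\<^sub>0 t"

lemma adaptive_Suc:
  "adaptive d s (Suc t) = adaptive d s t \<bind> (\<lambda>(x, c). asvrg_round (d * 2 ^ t) (s / 2 ^ t) x \<bind>
     (\<lambda>w. return_pmf (case w of (x', c') \<Rightarrow> (x', c + c'))))"
  by (simp add: asvrg_round_def Let_def split_def)

lemma adaptive_rounds_stop:
  assumes "0 < d" "0 < s"
  shows "adaptive_asvrg_rounds_stop n f g asvrg_step_size asvrg_momentum asvrg_epoch_length d s x\<^sub>0 T"
  unfolding adaptive_asvrg_rounds_stop_def Let_def
  using asvrg_round_correct(1)[of "d * 2 ^ t" "s / 2 ^ t" for t] assms by auto

lemma finite_adaptive: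
  assumes "0 < d" "0 < s"
  shows "finite (set_pmf (adaptive d s t))"
proof (induction t)
  case (Suc t)
  have "finite (set_pmf (asvrg_round (d * 2 ^ t) (s / 2 ^ t) x))" for x
    by (rule asvrg_round_correct(2)) (use assms in auto)
  thus ?case unfolding adaptive_Suc using Suc by (auto simp: set_bind_pmf split: prod.splits)
qed simp

text \<open>Round \<open>t\<close> has condition number \<open>d / s * 4 ^ t\<close>, so the square
  roots double from round to round and sum to \<open>2 ^ t - 1\<close> times the first.\<close>

lemma adaptive_cost:
  assumes "0 < d" "0 < s" and "(x, c) \<in> set_pmf (adaptive d s t)"
  shows "real c \<le> 30 * real n * real t + 42 * sqrt (real n) * sqrt (d / s) * (2 ^ t - 1)"
  using assms(3)
proof (induction t arbitrary: x c)
  case (Suc t)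
  then obtain x1 c1 c2 where 1: "(x1, c1) \<in> set_pmf (adaptive d s t)"
    and 2: "(x, c2) \<in> set_pmf (asvrg_round (d * 2 ^ t) (s / 2 ^ t) x1)" and c: "c = c1 + c2"
    unfolding adaptive_Suc by auto
  have "real c2 \<le> 30 * real n + 42 * sqrt (real n) * sqrt ((d * 2 ^ t) / (s / 2 ^ t))"
    by (rule asvrg_round_correct(4)[OF _ _ 2]) (use assms in auto)
  also have "(d * 2 ^ t) / (s / 2 ^ t) = d / s * (2 ^ t)\<^sup>2"
    by (simp add: power2_eq_square)
  also have "sqrt (d / s * (2 ^ t)\<^sup>2) = sqrt (d / s) * 2 ^ t"
    unfolding real_sqrt_mult by simp
  finally show ?case using Suc.IH[OF 1] unfolding c by (simp add: algebra_simps)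
qed simp

lemma adaptive_gap:
  fixes u :: 'a
  assumes d: "0 < d" and s: "0 < s"
    and s_le: "s * (norm (x\<^sub>0 - u))\<^sup>2 \<le> (F x\<^sub>0 - F u) / 3"
    and d_ge: "G\<^sup>2 / (2 * d) \<le> (F x\<^sub>0 - F u) / 8"
  shows "expected_value (F_smooth (d * 2 ^ t) (s / 2 ^ t)) (adaptive d s t) - F u \<le> (F x\<^sub>0 - F u) / 2 ^ t"
proof (induction t)
  case 0
  \<comment> \<open>The start \<open>x\<^sub>0\<close> is also the centre of the regularizer, which
    therefore vanishes there.\<close>
  show ?case using F_smooth_le[OF d, of s x\<^sub>0] by (simp add: expected_value_def)
next
  case (Suc t)
  define \<delta> where "\<delta> = d * 2 ^ t"
  define \<sigma> where "\<sigma> = s / 2 ^ t"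
  define b where "b = 3 / 4 * (F u + \<sigma> / 2 * (norm (u - x\<^sub>0))\<^sup>2) + G\<^sup>2 / (2 * \<delta>)"
  have \<delta>: "0 < \<delta>" and \<sigma>: "0 < \<sigma>" using d s by (simp_all add: \<delta>_def \<sigma>_def)
  let ?h = "\<lambda>(x, c :: nat). F_smooth (d * 2 ^ Suc t) (s / 2 ^ Suc t) x"
  let ?k = "\<lambda>(x, c :: nat). F_smooth \<delta> \<sigma> x"
  \<comment> \<open>The constants 3 and 8 in the hypotheses make regularization and smoothing each
    contribute 1/8 of the current bound; with the 1/4 from the stopping rule this gives 1/2.\<close>
  have "b \<le> 3 / 4 * F u + 3 / 8 * ((F x\<^sub>0 - F u) / 3 / 2 ^ t) + (F x\<^sub>0 - F u) / 8 / 2 ^ t"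
  proof -
    have "\<sigma> * (norm (u - x\<^sub>0))\<^sup>2 \<le> (F x\<^sub>0 - F u) / 3 / 2 ^ t"
      using divide_right_mono[OF s_le, of "2 ^ t"] by (simp add: \<sigma>_def norm_minus_commute)
    moreover have "G\<^sup>2 / (2 * \<delta>) \<le> (F x\<^sub>0 - F u) / 8 / 2 ^ t"
      using divide_right_mono[OF d_ge, of "2 ^ t"] by (simp add: \<delta>_def)
    moreover have "b = 3 / 4 * F u + 3 / 8 * (\<sigma> * (norm (u - x\<^sub>0))\<^sup>2) + G\<^sup>2 / (2 * \<delta>)"
      by (simp add: b_def algebra_simps)
    ultimately show ?thesis by linarith
  qed
  have "expected_value (F_smooth (d * 2 ^ Suc t) (s / 2 ^ Suc t)) (adaptive d s (Suc t))
      \<le> measure_pmf.expectation (adaptive d s t) (\<lambda>st. 1 / 4 * ?k st + b)"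
    unfolding expected_value_def adaptive_Suc \<delta>_def[symmetric] \<sigma>_def[symmetric]
  proof (rule expectation_bind_le[OF finite_adaptive[OF d s]])
    fix st :: "'a \<times> nat"
    obtain x c where st: "st = (x, c)" by (cases st)
    note fin = asvrg_round_correct(2)[OF \<delta> \<sigma>, of x]
    let ?q = "\<lambda>(x, c). asvrg_round \<delta> \<sigma> x \<bind> (\<lambda>w. return_pmf (case w of (x', c') \<Rightarrow> (x', c + c')))"
    show "finite (set_pmf (?q st))" using fin by (simp add: st)
    have "measure_pmf.expectation (?q st) ?h = measure_pmf.expectation (asvrg_round \<delta> \<sigma> x) ?h"
      using fin by (simp add: st expectation_bind_finite split_def)
    also have "\<dots> \<le> measure_pmf.expectation (asvrg_round \<delta> \<sigma> x) (\<lambda>w. 1 * ?k w + G\<^sup>2 / (2 * \<delta>))"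
    proof (rule expectation_mono_finite[OF fin])
      fix w :: "'a \<times> nat"
      have "F_smooth (d * 2 ^ Suc t) (s / 2 ^ Suc t) (fst w) \<le> F_smooth \<delta> \<sigma> (fst w) + G\<^sup>2 / (2 * \<delta>)"
        by (rule F_smooth_change[OF \<delta>]) (use d s in \<open>auto simp: \<sigma>_def field_simps\<close>)
      thus "?h w \<le> 1 * ?k w + G\<^sup>2 / (2 * \<delta>)" unfolding split_def mult_1 .
    qed
    also have "\<dots> = expected_value (F_smooth \<delta> \<sigma>) (asvrg_round \<delta> \<sigma> x) + G\<^sup>2 / (2 * \<delta>)"
      unfolding expectation_affine_finite[OF fin] expected_value_def by simp
    finally show "measure_pmf.expectation (?q st) ?h \<le> 1 / 4 * ?k st + b"
      using asvrg_round_correct(3)[OF \<delta> \<sigma>, of x u] unfolding b_def st by simp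
  qed
  also have "\<dots> = 1 / 4 * expected_value (F_smooth \<delta> \<sigma>) (adaptive d s t) + b"
    unfolding expectation_affine_finite[OF finite_adaptive[OF d s]] expected_value_def ..
  also have "\<dots> \<le> 1 / 4 * (F u + (F x\<^sub>0 - F u) / 2 ^ t) + b"
    using Suc.IH unfolding \<delta>_def \<sigma>_def by simp
  finally have "expected_value (F_smooth (d * 2 ^ Suc t) (s / 2 ^ Suc t)) (adaptive d s (Suc t))
      \<le> 1 / 4 * (F u + (F x\<^sub>0 - F u) / 2 ^ t) + b" .
  moreover have "1 / 4 * (F u + (F x\<^sub>0 - F u) / 2 ^ t)
      + (3 / 4 * F u + 3 / 8 * ((F x\<^sub>0 - F u) / 3 / 2 ^ t) + (F x\<^sub>0 - F u) / 8 / 2 ^ t)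
      = F u + (F x\<^sub>0 - F u) / 2 ^ Suc t"
    by (simp add: field_simps)
  ultimately show ?case using \<open>b \<le> _\<close> by argo
qed

text \<open>Returning from the surrogate to \<open>F\<close> adds the final smoothing error, which
  is at most 1/8 of the bound on the surrogate gap.\<close>

lemma adaptive_suboptimality:
  fixes u :: 'a
  assumes d: "0 < d" and s: "0 < s"
    and s_le: "s * (norm (x\<^sub>0 - u))\<^sup>2 \<le> (F x\<^sub>0 - F u) / 3"
    and d_ge: "G\<^sup>2 / (2 * d) \<le> (F x\<^sub>0 - F u) / 8"
  shows "expected_value F (adaptive d s t) - F u \<le> 9 / 8 * ((F x\<^sub>0 - F u) / 2 ^ t)"
proof -
  note fin = finite_adaptive[OF d s]
  have "expected_value F (adaptive d s t) \<le> measure_pmf.expectation (adaptive d s t)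
      (\<lambda>w. 1 * (case w of (x, c) \<Rightarrow> F_smooth (d * 2 ^ t) (s / 2 ^ t) x) + G\<^sup>2 / (2 * (d * 2 ^ t)))"
    unfolding expected_value_def
  proof (rule expectation_mono_finite[OF fin])
    fix w :: "'a \<times> nat"
    show "(case w of (x, c) \<Rightarrow> F x)
      \<le> 1 * (case w of (x, c) \<Rightarrow> F_smooth (d * 2 ^ t) (s / 2 ^ t) x) + G\<^sup>2 / (2 * (d * 2 ^ t))"
      using F_le_F_smooth[of "d * 2 ^ t" "s / 2 ^ t" "fst w"] d s by (simp add: split_def)
  qed
  also have "\<dots> = expected_value (F_smooth (d * 2 ^ t) (s / 2 ^ t)) (adaptive d s t) + G\<^sup>2 / (2 * (d * 2 ^ t))"
    unfolding expectation_affine_finite[OF fin] expected_value_def by simp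
  also have "G\<^sup>2 / (2 * (d * 2 ^ t)) \<le> (F x\<^sub>0 - F u) / 8 / 2 ^ t"
    using divide_right_mono[OF d_ge, of "2 ^ t"] by simp
  finally show ?thesis using adaptive_gap[OF assms, of t] by linarith
qed

end

section \<open>Initial parameters and total complexity\<close>

text \<open>The factor 2 inside the logarithm leaves room for the factor 9/8 in the final
  gap.\<close>

definition round_count :: "real \<Rightarrow> real \<Rightarrow> nat" where
  "round_count \<Delta> \<epsilon> = nat \<lceil>log 2 (2 * \<Delta> / \<epsilon>)\<rceil>"

text \<open>Chosen such that the product with \<open>D\<^sup>2\<close> is
  \<open>\<Delta> / 3\<close>, as \<open>adaptive_gap\<close> demands.\<close>

definition initial_regularization :: "real \<Rightarrow> real \<Rightarrow> real" where
  "initial_regularization \<Delta> D = \<Delta> / (3 * D\<^sup>2)"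

text \<open>
  The second summand keeps the smoothing parameter positive when \<open>G = 0\<close>; it contributes at
  most 1 to the condition number of every round.
\<close>

definition initial_smoothing :: "real \<Rightarrow> real \<Rightarrow> real \<Rightarrow> real \<Rightarrow> real" where
  "initial_smoothing \<Delta> D G \<epsilon> = 4 * G\<^sup>2 / \<Delta> + initial_regularization \<Delta> D / 4 ^ round_count \<Delta> \<epsilon>"

lemma round_count_bounds:
  assumes "0 < \<epsilon>" "\<epsilon> \<le> \<Delta> / 2"
  shows "2 * \<Delta> / \<epsilon> \<le> 2 ^ round_count \<Delta> \<epsilon>" and "2 ^ round_count \<Delta> \<epsilon> \<le> 4 * \<Delta> / \<epsilon>"
    and "1 \<le> real (round_count \<Delta> \<epsilon>)" and "real (round_count \<Delta> \<epsilon>) \<le> 9 / 2 * ln (\<Delta> / \<epsilon>)"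
proof -
  define l where "l = log 2 (\<Delta> / \<epsilon>)"
  define T where "T = round_count \<Delta> \<epsilon>"
  have q: "2 \<le> \<Delta> / \<epsilon>" using assms by (simp add: field_simps)
  have p: "2 powr l = \<Delta> / \<epsilon>" unfolding l_def using q by (intro powr_log_cancel) auto
  have l: "1 \<le> l" unfolding l_def using q by (subst le_log_iff) auto
  have "log 2 (2 * \<Delta> / \<epsilon>) = log 2 (2 * (\<Delta> / \<epsilon>))" by simp
  also have "\<dots> = 1 + l" unfolding l_def using q by (subst log_mult) auto
  finally have T: "T = nat \<lceil>1 + l\<rceil>" by (simp add: T_def round_count_def)
  have T1: "1 + l \<le> real T" and T2: "real T \<le> 2 + l" unfolding T using l by linarith+
  have pow: "(2::real) ^ T = 2 powr real T" by (simp add: powr_realpow)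
  have "2 powr (1 + l) \<le> 2 powr real T" using T1 by simp
  thus "2 * \<Delta> / \<epsilon> \<le> 2 ^ round_count \<Delta> \<epsilon>" unfolding T_def[symmetric] pow powr_add p by simp
  have "2 powr real T \<le> 2 powr (2 + l)" using T2 by simp
  thus "2 ^ round_count \<Delta> \<epsilon> \<le> 4 * \<Delta> / \<epsilon>" unfolding T_def[symmetric] pow powr_add p by simp
  show "1 \<le> real (round_count \<Delta> \<epsilon>)" using T1 l unfolding T_def by simp
  \<comment> \<open>Since \<open>1 \<le> l\<close>, the round count is at most
    \<open>2 + l \<le> 3 * l\<close>; the bound \<open>2 / 3 \<le> ln 2\<close> converts
    \<open>l\<close> into a natural logarithm.\<close>
  have "l * (2 / 3) \<le> l * ln 2" using l ln2_ge_two_thirds by (intro mult_left_mono) auto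
  also have "\<dots> = ln (\<Delta> / \<epsilon>)" unfolding l_def by (simp add: log_def)
  finally have "3 * l \<le> 9 / 2 * ln (\<Delta> / \<epsilon>)" by simp
  thus "real (round_count \<Delta> \<epsilon>) \<le> 9 / 2 * ln (\<Delta> / \<epsilon>)" using T2 l unfolding T_def by linarith
qed

text \<open>The quotient is \<open>12 * (G * D / \<Delta>)\<^sup>2\<close> plus the square of
  \<open>?b\<close>. Here 12 is at most the square of 7/2, and a sum of squares of nonnegative
  numbers is at most the square of their sum.\<close>

lemma sqrt_initial_condition_le:
  assumes "0 < \<Delta>" "0 < D" "0 \<le> G"
  shows "sqrt (initial_smoothing \<Delta> D G \<epsilon> / initial_regularization \<Delta> D)
    \<le> 7 / 2 * (G * D / \<Delta>) + 1 / 2 ^ round_count \<Delta> \<epsilon>"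
proof (rule real_le_lsqrt[OF _ _, simplified])
  let ?T = "round_count \<Delta> \<epsilon>"
  let ?a = "7 / 2 * (G * D / \<Delta>)" and ?b = "1 / 2 ^ ?T :: real"
  have s: "0 < initial_regularization \<Delta> D" using assms by (simp add: initial_regularization_def)
  have ab: "0 \<le> ?a * ?b" using assms by simp
  show "0 \<le> ?a + ?b" using assms by (intro add_nonneg_nonneg) auto
  have "initial_smoothing \<Delta> D G \<epsilon> / initial_regularization \<Delta> D
      = 4 * G\<^sup>2 / \<Delta> / initial_regularization \<Delta> D + 1 / 4 ^ ?T"
    using s unfolding initial_smoothing_def by (simp add: add_divide_distrib)
  also have "4 * G\<^sup>2 / \<Delta> / initial_regularization \<Delta> D = 12 * (G * D / \<Delta>)\<^sup>2"
    unfolding initial_regularization_def using assms by (simp add: power2_eq_square field_simps)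
  also have "\<dots> \<le> ?a\<^sup>2" by (simp only: power_mult_distrib) (intro mult_right_mono, auto simp: power2_eq_square)
  also have "1 / 4 ^ ?T = ?b\<^sup>2"
    by (simp add: power_divide power_mult[symmetric] mult.commute[of _ 2] power_mult)
  also have "?a\<^sup>2 + ?b\<^sup>2 \<le> (?a + ?b)\<^sup>2" using ab unfolding power2_sum by linarith
  finally show "initial_smoothing \<Delta> D G \<epsilon> / initial_regularization \<Delta> D \<le> (?a + ?b)\<^sup>2" by simp
qed

lemma adaptive_asvrg_guarantee:
  fixes f :: "nat \<Rightarrow> 'a::euclidean_space \<Rightarrow> real" and x\<^sub>0 x_star :: 'a and G \<epsilon> :: real
  assumes n: "n \<ge> 1" and f: "\<forall>i\<in>{1..n}. convex_on UNIV (f i) \<and> G-lipschitz_on UNIV (f i)"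
    and g: "convex_on UNIV g"
  defines "F \<equiv> finite_sum_objective n f g"
  defines "\<Delta> \<equiv> F x\<^sub>0 - F x_star"
  defines "D \<equiv> norm (x\<^sub>0 - x_star)"
  defines "d \<equiv> initial_smoothing \<Delta> D G \<epsilon>"
  defines "s \<equiv> initial_regularization \<Delta> D"
  defines "T \<equiv> round_count \<Delta> \<epsilon>"
  defines "result \<equiv> adaptive_asvrg n f g asvrg_step_size asvrg_momentum asvrg_epoch_length d s x\<^sub>0 T"
  assumes \<epsilon>: "0 < \<epsilon>" and \<epsilon>_le: "\<epsilon> \<le> \<Delta> / 2"
  shows "0 < d \<and> 0 < s \<and>
    adaptive_asvrg_rounds_stop n f g asvrg_step_size asvrg_momentum asvrg_epoch_length d s x\<^sub>0 T \<and>
    expected_value F result - F x_star \<le> \<epsilon> \<and>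
    (\<forall>(x, c)\<in>set_pmf result. real c \<le> 1000 * (real n * ln (\<Delta> / \<epsilon>) + sqrt (real n) * G * D / \<epsilon>))"
proof -
  interpret finite_sum_lipschitz n f g G x\<^sub>0
    using n f g by unfold_locales auto
  have \<Delta>: "0 < \<Delta>" using \<epsilon> \<epsilon>_le by simp
  \<comment> \<open>A positive gap separates \<open>x\<^sub>0\<close> from \<open>x_star\<close>, so
    the division by \<open>D\<^sup>2\<close> in \<open>s\<close> is a proper one.\<close>
  hence D: "0 < D" by (auto simp: \<Delta>_def D_def)
  have G: "0 \<le> G" using f_lipschitz[of 1] n by (auto intro: lipschitz_on_nonneg)
  have s: "0 < s" using \<Delta> D by (simp add: s_def initial_regularization_def)
  have d: "0 < d" unfolding d_def initial_smoothing_def s_def[symmetric] using s \<Delta>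
    by (intro add_nonneg_pos) auto
  have s_le: "s * (norm (x\<^sub>0 - x_star))\<^sup>2 \<le> (F x\<^sub>0 - F x_star) / 3"
    unfolding s_def initial_regularization_def D_def[symmetric] \<Delta>_def[symmetric] using D by simp
  have "4 * G\<^sup>2 / \<Delta> \<le> d" unfolding d_def initial_smoothing_def s_def[symmetric] using s by simp
  hence "G\<^sup>2 / (2 * d) \<le> \<Delta> / 8" using d \<Delta> by (simp add: field_simps)
  hence d_ge: "G\<^sup>2 / (2 * d) \<le> (F x\<^sub>0 - F x_star) / 8"
    by (simp add: \<Delta>_def)
  note T = round_count_bounds[OF \<epsilon> \<epsilon>_le, folded T_def]
  have stop: "adaptive_asvrg_rounds_stop n f g asvrg_step_size asvrg_momentum asvrg_epoch_length d s x\<^sub>0 T"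
    by (rule adaptive_rounds_stop[OF d s])
  have "\<Delta> / 2 ^ T \<le> \<epsilon> / 2" using T(1) \<epsilon> by (simp add: field_simps)
  hence gap: "expected_value F (adaptive d s T) - F x_star \<le> \<epsilon>"
    using adaptive_suboptimality[OF d s s_le[unfolded F_def] d_ge[unfolded F_def], of T] \<epsilon>
    unfolding F_def[symmetric] \<Delta>_def[symmetric]
    by linarith
  have cost: "real c \<le> 1000 * (real n * ln (\<Delta> / \<epsilon>) + sqrt (real n) * G * D / \<epsilon>)"
    if "(x, c) \<in> set_pmf (adaptive d s T)" for x c
  proof -
    \<comment> \<open>The upper bound \<open>4 * \<Delta> / \<epsilon>\<close> on
      \<open>2 ^ T\<close> cancels \<open>\<Delta>\<close>, and the term that keeps the smoothing
      positive contributes only 1.\<close>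
    have "sqrt (d / s) * (2 ^ T - 1) \<le> (7 / 2 * (G * D / \<Delta>) + 1 / 2 ^ T) * 2 ^ T"
      unfolding d_def s_def T_def using \<Delta> D G
      by (intro mult_mono sqrt_initial_condition_le) auto
    also have "\<dots> = 7 / 2 * (G * D / \<Delta>) * 2 ^ T + 1" by (simp add: algebra_simps)
    also have "\<dots> \<le> 7 / 2 * (G * D / \<Delta>) * (4 * \<Delta> / \<epsilon>) + 1"
      using T(2) G D \<Delta> by (intro add_right_mono mult_left_mono) auto
    also have "\<dots> = 14 * (G * D / \<epsilon>) + 1" using \<Delta> by simp
    finally have "42 * sqrt (real n) * (sqrt (d / s) * (2 ^ T - 1)) \<le> 42 * sqrt (real n) * (14 * (G * D / \<epsilon>) + 1)"
      by (intro mult_left_mono) auto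
    also have "\<dots> = 588 * (sqrt (real n) * G * D / \<epsilon>) + 42 * sqrt (real n)"
      by (simp add: algebra_simps)
    finally have "42 * sqrt (real n) * (sqrt (d / s) * (2 ^ T - 1))
        \<le> 588 * (sqrt (real n) * G * D / \<epsilon>) + 42 * sqrt (real n)" .
    \<comment> \<open>The leftover \<open>42 * sqrt (real n)\<close> is charged to the linear term,
      raising its factor from 30 to 72; this uses that at least one round is run.\<close>
    moreover have "sqrt (real n) \<le> real n * real T"
    proof -
      have "sqrt (real n) \<le> real n * 1" using n by (simp add: real_le_lsqrt power2_eq_square)
      also have "\<dots> \<le> real n * real T" using T(3) by (intro mult_left_mono) auto
      finally show ?thesis .
    qed
    ultimately have "real c \<le> 72 * (real n * real T) + 588 * (sqrt (real n) * G * D / \<epsilon>)"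
      using adaptive_cost[OF d s that] unfolding mult.assoc by linarith
    also have "real n * real T \<le> real n * (9 / 2 * ln (\<Delta> / \<epsilon>))"
      using T(4) by (intro mult_left_mono) auto
    finally have "real c \<le> 324 * (real n * ln (\<Delta> / \<epsilon>)) + 588 * (sqrt (real n) * G * D / \<epsilon>)"
      by simp
    moreover have "0 \<le> real n * ln (\<Delta> / \<epsilon>)" using T(3,4) by simp
    moreover have "0 \<le> sqrt (real n) * G * D / \<epsilon>" using G D \<epsilon> by simp
    moreover have "r \<le> 1000 * (A + B)" if "r \<le> 324 * A + 588 * B" "0 \<le> A" "0 \<le> B" for A B r :: real
      using that unfolding distrib_left by linarith
    ultimately show ?thesis by blast
  qed
  show ?thesis unfolding result_def using d s stop gap cost by auto
qed

theorem corollary15: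
  shows "\<exists>(\<delta>\<^sub>0 :: real \<Rightarrow> real \<Rightarrow> real \<Rightarrow> real \<Rightarrow> real)
          (\<sigma>\<^sub>0 :: real \<Rightarrow> real \<Rightarrow> real \<Rightarrow> real \<Rightarrow> real)
          (T :: real \<Rightarrow> real \<Rightarrow> real \<Rightarrow> real \<Rightarrow> nat)
          (\<eta> :: nat \<Rightarrow> real \<Rightarrow> real \<Rightarrow> real)
          (\<omega> :: nat \<Rightarrow> real \<Rightarrow> real \<Rightarrow> real)
          (m :: nat \<Rightarrow> real \<Rightarrow> real \<Rightarrow> nat).
    (\<forall>n\<ge>1. \<forall>L>0. \<forall>\<mu>>0. asvrg_admissible L (\<eta> n L \<mu>) (\<omega> n L \<mu>) (m n L \<mu>)) \<and>
    (\<forall>(n :: nat) (f :: nat \<Rightarrow> 'a::euclidean_space \<Rightarrow> real) (g :: 'a \<Rightarrow> real)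
       (G :: real) (x_star :: 'a) (x\<^sub>0 :: 'a) (\<epsilon> :: real).
       let F = finite_sum_objective n f g;
           \<Delta> = F x\<^sub>0 - F x_star;
           D = norm (x\<^sub>0 - x_star);
           d\<^sub>0 = \<delta>\<^sub>0 \<Delta> D G \<epsilon>;
           s\<^sub>0 = \<sigma>\<^sub>0 \<Delta> D G \<epsilon>;
           N = T \<Delta> D G \<epsilon>;
           result = adaptive_asvrg n f g \<eta> \<omega> m d\<^sub>0 s\<^sub>0 x\<^sub>0 N
       in n \<ge> 1 \<longrightarrow>
          (\<forall>i\<in>{1..n}. convex_on UNIV (f i) \<and> G-lipschitz_on UNIV (f i)) \<longrightarrow>
          convex_on UNIV g \<longrightarrow>
          (\<forall>x. F x_star \<le> F x) \<longrightarrow>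
          0 < \<epsilon> \<longrightarrow> \<epsilon> \<le> \<Delta> / 2 \<longrightarrow>
          0 < d\<^sub>0 \<and> 0 < s\<^sub>0 \<and>
          adaptive_asvrg_rounds_stop n f g \<eta> \<omega> m d\<^sub>0 s\<^sub>0 x\<^sub>0 N \<and>
          expected_value F result - F x_star \<le> \<epsilon> \<and>
          (\<forall>(x, c)\<in>set_pmf result.
             real c \<le> 1000 * (real n * ln (\<Delta> / \<epsilon>) + sqrt (real n) * G * D / \<epsilon>)))"
  unfolding Let_def
proof (rule exI[of _ initial_smoothing], rule exI[of _ "\<lambda>\<Delta> D G \<epsilon>. initial_regularization \<Delta> D"],
    rule exI[of _ "\<lambda>\<Delta> D G \<epsilon>. round_count \<Delta> \<epsilon>"], rule exI[of _ asvrg_step_size],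
    rule exI[of _ asvrg_momentum], rule exI[of _ asvrg_epoch_length], rule conjI)
  show "\<forall>n\<ge>1. \<forall>L>0. \<forall>\<mu>>0. asvrg_admissible L (asvrg_step_size n L \<mu>) (asvrg_momentum n L \<mu>)
      (asvrg_epoch_length n L \<mu>)"
    using asvrg_parameters_admissible by blast
qed (intro allI impI, rule adaptive_asvrg_guarantee)

end
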